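(* Let $\{r_n\}$ and $\{z_n\}$ be nonnegative stochastic sequences adapted to a filtration $\{\mathcal F_n\}$, let $\theta_n\in[c,d]\subset[0,1)$, let $h>0$ be a constant, and let $\{\eta_n\},\{\bar\eta_n\},\{\beta_n\},\{\bar\beta_n\},\{\zeta_n\}$ be nonnegative sequences with $\sum_{n=1}^\infty\beta_n<\infty$ and $\sum_{n=1}^\infty\bar\beta_n<\infty$ almost surely. Suppose that, for all $n\ge1$, $$\mathbb E[r_{n+2}\mid\mathcal F_{n+1}]\le\big((1+\theta_n)r_{n+1}-\theta_nr_n\big)-\eta_n+\beta_n+h\zeta_nz_{n+1},$$ $$\mathbb E[z_{n+2}\mid\mathcal F_{n+1}]\le(1-\zeta_n)z_{n+1}-\bar\eta_n+\bar\beta_n.$$ Then $\{r_n\}$ and $\{z_n\}$ converge almost surely to some finite random variables, and $\sum_{k=1}^\infty\eta_k<+\infty$ almost surely. Furthermore, if $\sum_{n=1}^\infty\zeta_n=\infty$, then $z_{n+1}$ converges to $0$ almost surely and $r_{n+1}$ converges to some random variable $r_\infty$ almost surely.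
   Context: All random variables are real-valued and live on a common probability space; $\{\theta_n\}$ is a deterministic sequence; $\eta_n,\bar\eta_n,\beta_n,\bar\beta_n,\zeta_n$ may be random, in which case they are $\mathcal F_{n+1}$-measurable; inequalities between random variables hold almost surely. *)

theory Defs
  imports "HOL-Probability.Probability"
begin

(* The conditional expectation of a nonnegative random variable always exists, with values in
   [0, infinity]; no integrability is needed. The value lives in ereal rather than ennreal so
   that it can be compared with real right-hand sides that are not known in advance to be
   nonnegative. (real_cond_exp is unsuitable here: it takes the value 0 at points where the
   conditional expectation is infinite.) *)
definition nonneg_cond_exp :: "'a measure \<Rightarrow> 'a measure \<Rightarrow> ('a \<Rightarrow> real) \<Rightarrow> 'a \<Rightarrow> ereal" where
  "nonneg_cond_exp M F X = (\<lambda>\<omega>. enn2ereal (nn_cond_exp M F (\<lambda>\<omega>'. ennreal (X \<omega>')) \<omega>))"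

(* For integrable nonnegative X this is the usual conditional expectation. *)
lemma nonneg_cond_exp_eq_real_cond_exp:
  assumes "prob_space M" "subalgebra M F" "integrable M X" "AE \<omega> in M. 0 \<le> X \<omega>"
  shows "AE \<omega> in M. nonneg_cond_exp M F X \<omega> = ereal (real_cond_exp M F X \<omega>)"
proof -
  interpret prob_space M by fact
  interpret finite_measure_subalgebra M F
    by unfold_locales fact
  have [measurable]: "X \<in> borel_measurable M" using assms(3) by simp
  have "(\<integral>\<^sup>+ \<omega>. nn_cond_exp M F (\<lambda>\<omega>. ennreal (X \<omega>)) \<omega> \<partial>M) = (\<integral>\<^sup>+ \<omega>. ennreal (X \<omega>) \<partial>M)"
    by (rule nn_cond_exp_intg[of "\<lambda>_. 1", simplified]) auto
  also have "\<dots> < \<infinity>"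
    using assms(3,4) by (simp add: integrable_iff_bounded nn_integral_eq_integral ennreal_less_top)
  finally have fin: "AE \<omega> in M. nn_cond_exp M F (\<lambda>\<omega>. ennreal (X \<omega>)) \<omega> \<noteq> \<infinity>"
    by (intro nn_integral_noteq_infinite) (auto intro: measurable_from_subalg[OF subalg])
  have "AE \<omega> in M. nn_cond_exp M F (\<lambda>\<omega>. ennreal (- X \<omega>)) \<omega> = nn_cond_exp M F (\<lambda>_. 0) \<omega>"
    using assms(4) by (intro nn_cond_exp_cong) (auto simp: ennreal_neg)
  moreover have "AE \<omega> in M. (0::ennreal) = nn_cond_exp M F (\<lambda>_. 0) \<omega>"
    by (rule nn_cond_exp_F_meas) auto
  ultimately show ?thesis
    using fin
  proof eventually_elim
    case (elim \<omega>)
    then show ?case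
      by (cases "nn_cond_exp M F (\<lambda>\<omega>. ennreal (X \<omega>)) \<omega>")
         (auto simp: nonneg_cond_exp_def real_cond_exp_def enn2ereal_ennreal)
  qed
qed

end

(* Let a n = theta n + theta n * theta (n+1) + ..., which is bounded since theta <= d < 1 and
   satisfies a n = theta n * (1 + a (n+1)). For x = r (or x = z, with theta = 0) put
   V n = (1 + a n) * x (n+1) - a n * x n. The recursion becomes a Robbins-Siegmund inequality
   E[V (n+1) | F] <= V n - (1 + a (n+1)) * (eta n - gamma n), and if x is bounded, then
   convergence of V forces x to the same limit, because x (n+1) depends on x n with contraction
   factor a n / (1 + a n) < 1.

   V is not bounded below. Stopping when x exceeds K or the sum of gamma exceeds m gives a
   supermartingale bounded below by -const * K, which converges by Doob's upcrossing inequality.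
   So everything follows wherever sup x is finite. If sup x were infinite with positive
   probability p and with the sum of gamma at most m, then the limit of the stopped process would
   be at least about K there, and elsewhere at least -const * min K g for a finite g that does not
   depend on K, namely x at the time the sum of gamma first exceeds m. By Fatou
   K * p <= const + const * E[min K g], and dividing by K -> infinity gives p = 0.

   The case of z yields summability of zeta n * z (n+1), so that h * zeta n * z (n+1) can be
   absorbed into gamma in the case of r. *)
theory Submission
  imports Defs
begin

section \<open>Inertial sequences\<close>

text \<open>The weight \<open>a n\<close> is the series over \<open>j\<close> of the products
  \<open>\<theta> n * ... * \<theta> (n + j)\<close>, dominated by the geometric series of
  \<open>d ^ (j + 1)\<close>. Splitting off the term \<open>j = 0\<close> and pulling the common
  factor \<open>\<theta> n\<close> out of the rest gives the recursion.\<close>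

lemma inertial_weights:
  fixes \<theta> :: "nat \<Rightarrow> real"
  assumes "\<And>n. 0 \<le> \<theta> n" "\<And>n. \<theta> n \<le> d" "d < 1"
  obtains a where "\<And>n. a n = \<theta> n * (1 + a (Suc n))" "\<And>n. 0 \<le> a n" "\<And>n. a n \<le> d / (1 - d)"
proof -
  define p where "p n j = (\<Prod>i\<le>j. \<theta> (n + i))" for n j
  have d: "0 \<le> d" using assms(1,2)[of 0] by linarith
  have p0: "0 \<le> p n j" for n j unfolding p_def by (intro prod_nonneg) (simp add: assms)
  have pd: "p n j \<le> d * d ^ j" for n j
  proof -
    have "p n j \<le> (\<Prod>i\<le>j. d)" unfolding p_def by (intro prod_mono) (simp add: assms)
    then show ?thesis by simp
  qed
  have geo: "(\<lambda>j. d * d ^ j) sums (d * (1 / (1 - d)))"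
    using d assms(3) by (intro sums_mult geometric_sums) auto
  have sm: "summable (p n)" for n
    by (rule summable_comparison_test'[OF sums_summable[OF geo], of 0])
       (use p0 pd in \<open>auto simp: abs_of_nonneg\<close>)
  have pS: "p n (Suc j) = \<theta> n * p (Suc n) j" for n j
    unfolding p_def by (subst prod.atMost_Suc_shift) simp
  have "suminf (p n) = \<theta> n * (1 + suminf (p (Suc n)))" for n
  proof -
    have "suminf (p n) = (\<Sum>j. p n (Suc j)) + p n 0"
      using suminf_split_head[OF sm[of n]] by simp
    also have "(\<Sum>j. p n (Suc j)) = \<theta> n * suminf (p (Suc n))"
      unfolding pS by (rule suminf_mult[OF sm])
    moreover have "p n 0 = \<theta> n" by (simp add: p_def)
    ultimately show ?thesis by (simp add: algebra_simps)
  qed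
  moreover have "0 \<le> suminf (p n)" for n by (rule suminf_nonneg[OF sm p0])
  moreover have "suminf (p n) \<le> d / (1 - d)" for n
    using suminf_le[OF pd sm sums_summable[OF geo]] sums_unique[OF geo] by simp
  ultimately show ?thesis by (rule that[of "\<lambda>n. suminf (p n)"])
qed

text \<open>Taking the limsup \<open>l\<close> of both sides gives \<open>l \<le> q * l\<close>; the
  bound \<open>B\<close> makes \<open>l\<close> finite, so \<open>q < 1\<close> forces
  \<open>l = 0\<close>.\<close>

lemma contraction_tendsto_zero:
  fixes y e :: "nat \<Rightarrow> real"
  assumes rec: "\<And>n. y (Suc n) \<le> q * y n + e n" and y0: "\<And>n. 0 \<le> y n"
    and q: "0 \<le> q" "q < 1" and e: "e \<longlonglongrightarrow> 0" and bdd: "\<And>n. y n \<le> B"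
  shows "y \<longlonglongrightarrow> 0"
proof -
  let ?l = "limsup (\<lambda>n. ereal (y n))"
  have le: "?l \<le> ereal B" by (intro Limsup_bounded) (simp add: bdd)
  have ge: "0 \<le> ?l"
    using Limsup_mono[of "\<lambda>_. 0" "\<lambda>n. ereal (y n)" sequentially] y0 by (simp add: Limsup_const)
  obtain l where l: "?l = ereal l" "0 \<le> l" using le ge by (cases ?l) auto
  have "?l = limsup (\<lambda>n. ereal (y (Suc n)))"
    using limsup_shift[of "\<lambda>n. ereal (y n)"] by simp
  also have "\<dots> \<le> limsup (\<lambda>n. ereal (q * y n) + ereal (e n))"
    by (intro Limsup_mono) (simp add: rec)
  also have "\<dots> \<le> limsup (\<lambda>n. ereal (q * y n)) + limsup (\<lambda>n. ereal (e n))"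
    by (rule ereal_limsup_add_mono)
  also have "limsup (\<lambda>n. ereal (e n)) = 0"
    using e by (intro lim_imp_Limsup) (auto simp: zero_ereal_def)
  also have "limsup (\<lambda>n. ereal (q * y n)) = ereal q * ?l"
    using Limsup_ereal_mult_left[of sequentially q "\<lambda>n. ereal (y n)"] q by simp
  finally have "l \<le> q * l" using l by simp
  then have "l * (1 - q) \<le> 0" by (simp add: algebra_simps)
  then have "l = 0" using l(2) q(2) by (simp add: mult_le_0_iff)
  show ?thesis
  proof (rule limsup_le_liminf_real)
    show "?l \<le> ereal 0" using l \<open>l = 0\<close> by simp
    show "ereal 0 \<le> liminf (\<lambda>n. ereal (y n))"
      by (intro Liminf_bounded) (simp add: y0)
  qed
qed

text \<open>Solving the formula for \<open>V n\<close> for \<open>x (Suc n)\<close> shows that the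
  error \<open>x n - L\<close> is contracted by \<open>a n / (1 + a n)\<close> in each step, up to a
  term that vanishes because \<open>V\<close> tends to \<open>L\<close>.\<close>

lemma inertial_tendsto:
  fixes x a V :: "nat \<Rightarrow> real"
  assumes a: "\<And>n. 0 \<le> a n" "\<And>n. a n \<le> C"
    and V: "\<And>n. V n = (1 + a n) * x (Suc n) - a n * x n"
    and x: "\<And>n. \<bar>x n\<bar> \<le> B" and L: "V \<longlonglongrightarrow> L"
  shows "x \<longlonglongrightarrow> L"
proof -
  have C: "0 \<le> C" using a[of 0] by linarith
  define q where "q = C / (1 + C)"
  have q: "0 \<le> q" "q < 1" using C by (auto simp: q_def)
  have "(\<lambda>n. \<bar>x n - L\<bar>) \<longlonglongrightarrow> 0"
  proof (rule contraction_tendsto_zero[where q=q and e="\<lambda>n. \<bar>V n - L\<bar>" and B="B + \<bar>L\<bar>"])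
    fix n
    \<comment> \<open>Since \<open>t / (1 + t)\<close> increases in \<open>t\<close>, the bound
      \<open>C\<close> on the weights yields one contraction factor below 1 for all
      \<open>n\<close>.\<close>
    have an: "a n / (1 + a n) \<le> q" 
      using a[of n] C by (auto simp: q_def field_simps)
    have "x (Suc n) - L = a n / (1 + a n) * (x n - L) + (V n - L) / (1 + a n)"
    proof -
      have "1 + a n \<noteq> 0" using a(1)[of n] by linarith
      moreover have "(1 + a n) * (x (Suc n) - L) = a n * (x n - L) + (V n - L)"
        by (simp add: V algebra_simps)
      ultimately show ?thesis
        by (metis add_divide_distrib nonzero_mult_div_cancel_left times_divide_eq_left)
    qed
    then have "\<bar>x (Suc n) - L\<bar> \<le> \<bar>a n / (1 + a n) * (x n - L)\<bar> + \<bar>(V n - L) / (1 + a n)\<bar>"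
      by (simp only: abs_triangle_ineq)
    also have "\<bar>a n / (1 + a n) * (x n - L)\<bar> = a n / (1 + a n) * \<bar>x n - L\<bar>"
      using a(1)[of n] by (simp add: abs_mult)
    also have "\<dots> \<le> q * \<bar>x n - L\<bar>" by (intro mult_right_mono an) simp
    also have "\<bar>(V n - L) / (1 + a n)\<bar> = \<bar>V n - L\<bar> / (1 + a n)"
      using a(1)[of n] by simp
    also have "\<dots> \<le> \<bar>V n - L\<bar>"
      using a(1)[of n] by (simp add: divide_le_eq mult_right_le_one_le algebra_simps)
    finally show "\<bar>x (Suc n) - L\<bar> \<le> q * \<bar>x n - L\<bar> + \<bar>V n - L\<bar>" by simp
    show "\<bar>x n - L\<bar> \<le> B + \<bar>L\<bar>" using x[of n] by linarith
  next
    show "(\<lambda>n. \<bar>V n - L\<bar>) \<longlonglongrightarrow> 0"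
      using L by (simp add: tendsto_rabs_zero_iff LIM_zero_iff)
  qed (use q in auto)
  then show ?thesis by (simp add: tendsto_rabs_zero_iff LIM_zero_iff)
qed

section \<open>Convergence of supermartingales bounded below\<close>

text \<open>True between a time at which y lies below a and the next time at which it exceeds b;
  this is the predictable strategy of Doob's upcrossing argument.\<close>

fun upcrossing_state :: "real \<Rightarrow> real \<Rightarrow> (nat \<Rightarrow> real) \<Rightarrow> nat \<Rightarrow> bool" where
  "upcrossing_state a b y 0 \<longleftrightarrow> y 0 < a"
| "upcrossing_state a b y (Suc n) \<longleftrightarrow>
     (if upcrossing_state a b y n then y (Suc n) \<le> b else y (Suc n) < a)"

definition upcrossing_at :: "real \<Rightarrow> real \<Rightarrow> (nat \<Rightarrow> real) \<Rightarrow> nat \<Rightarrow> bool" where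
  "upcrossing_at a b y k \<longleftrightarrow> upcrossing_state a b y k \<and> \<not> upcrossing_state a b y (Suc k)"

text \<open>The right-hand side is the profit of holding \<open>y\<close> while the state is true.
  Every position is bought below \<open>a\<close> and sold above \<open>b\<close>, so a completed
  one earns at least \<open>b - a\<close>; the second summand on the left accounts for a position
  still open at time \<open>n\<close>, and with it the induction closes.\<close>

lemma upcrossing_gain:
  assumes "a \<le> b"
  shows "(b - a) * (\<Sum>k<n. of_bool (upcrossing_at a b y k))
      + of_bool (upcrossing_state a b y n) * (y n - a)
    \<le> (\<Sum>k<n. of_bool (upcrossing_state a b y k) * (y (Suc k) - y k))"
proof (induction n)
  case (Suc n)
  then show ?case using assms
    by (cases "upcrossing_state a b y n"; cases "upcrossing_state a b y (Suc n)")
       (auto simp: upcrossing_at_def algebra_simps simp del: upcrossing_state.simps(2),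
        auto)
qed auto

text \<open>After the last upcrossing the state can no longer switch from true to false. Either it
  becomes true and stays so, which keeps \<open>y\<close> below \<open>b\<close>, or it stays false,
  which keeps \<open>y\<close> above \<open>a\<close>.\<close>

lemma eventually_le_or_ge_if_finite_upcrossings:
  assumes "a < b" "finite {k. upcrossing_at a b y k}"
  shows "(\<forall>\<^sub>F n in sequentially. y n \<le> b) \<or> (\<forall>\<^sub>F n in sequentially. a \<le> y n)"
proof -
  obtain N where N: "\<And>k. k \<ge> N \<Longrightarrow> \<not> upcrossing_at a b y k"
    using assms(2) by (metis finite_nat_set_iff_bounded mem_Collect_eq not_less)
  show ?thesis
  proof (cases "\<exists>m\<ge>N. upcrossing_state a b y m")
    case True
    then obtain m where m: "m \<ge> N" "upcrossing_state a b y m" by auto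
    have st: "upcrossing_state a b y n" if "n \<ge> m" for n
      using that
    proof (induction n rule: dec_induct)
      case (step n)
      then show ?case using N[of n] m(1) unfolding upcrossing_at_def by auto
    qed (use m in auto)
    have "y n \<le> b" if "n \<ge> m" for n
      using st[OF that] assms(1) by (cases n) (auto split: if_splits)
    then show ?thesis unfolding eventually_sequentially by blast
  next
    case False
    have "a \<le> y n" if "n \<ge> Suc N" for n
      using that False[simplified, rule_format, of n] False[simplified, rule_format, of "n - 1"]
      by (cases n) auto
    then show ?thesis unfolding eventually_sequentially by blast
  qed
qed

text \<open>If liminf and limsup differed, two rationals would fit strictly between them, and the
  sequence would be infinitely often below the smaller and above the larger one. Restricting to
  rational levels leaves countably many exceptional null sets later.\<close>

lemma Liminf_eq_Limsup_if_finite_upcrossings: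
  fixes y :: "nat \<Rightarrow> real"
  assumes "\<And>a b. a \<in> \<rat> \<Longrightarrow> b \<in> \<rat> \<Longrightarrow> a < b \<Longrightarrow> finite {k. upcrossing_at a b y k}"
  shows "liminf (\<lambda>n. ereal (y n)) = limsup (\<lambda>n. ereal (y n))"
proof (rule ccontr)
  let ?i = "liminf (\<lambda>n. ereal (y n))" and ?s = "limsup (\<lambda>n. ereal (y n))"
  assume "?i \<noteq> ?s"
  then have "?i < ?s" using Liminf_le_Limsup[of sequentially "\<lambda>n. ereal (y n)"] by simp
  then obtain u where u: "?i < ereal (real_of_rat u)" "ereal (real_of_rat u) < ?s"
    using ereal_dense3 by blast
  then obtain v where v: "ereal (real_of_rat u) < ereal (real_of_rat v)" "ereal (real_of_rat v) < ?s"
    using ereal_dense3[of "ereal (real_of_rat u)" ?s] by blast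
  have "finite {k. upcrossing_at (real_of_rat u) (real_of_rat v) y k}"
    using v by (intro assms) auto
  from eventually_le_or_ge_if_finite_upcrossings[OF _ this] v(1)
  consider "\<forall>\<^sub>F n in sequentially. y n \<le> real_of_rat v" | "\<forall>\<^sub>F n in sequentially. real_of_rat u \<le> y n"
    by auto
  then show False
  proof cases
    case 1
    then have "?s \<le> ereal (real_of_rat v)" by (intro Limsup_bounded) (simp add: eventually_mono)
    then show ?thesis using v by simp
  next
    case 2
    then have "ereal (real_of_rat u) \<le> ?i" by (intro Liminf_bounded) (simp add: eventually_mono)
    then show ?thesis using u by simp
  qed
qed

section \<open>Doob's upcrossing inequality and convergence\<close>

text \<open>The supermartingale property is expressed by integrals over events of \<open>H n\<close>
  instead of conditional expectations. The truncated recursion delivers it in this form, and betting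
  strategies consume it in this form.\<close>

locale supermartingale = prob_space M for M :: "'a measure" +
  fixes H :: "nat \<Rightarrow> 'a measure" and Y :: "nat \<Rightarrow> 'a \<Rightarrow> real"
  assumes sub: "\<And>n. subalgebra M (H n)"
    and mono: "\<And>m n. m \<le> n \<Longrightarrow> sets (H m) \<subseteq> sets (H n)"
    and meas: "\<And>n. Y n \<in> borel_measurable (H n)"
    and int: "\<And>n. integrable M (Y n)"
    and decr: "\<And>n B. B \<in> sets (H n) \<Longrightarrow> (\<integral>\<omega>. indicator B \<omega> * (Y (Suc n) \<omega> - Y n \<omega>) \<partial>M) \<le> 0"
begin

text \<open>Each summand integrates the increment over the event that the bet \<open>c k\<close> is
  placed; this event lies in \<open>H k\<close>, so \<open>decr\<close> applies to it.\<close>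

lemma
  assumes c: "\<And>n. Measurable.pred (H n) (c n)"
  shows supermartingale_transform_integrable:
      "integrable M (\<lambda>\<omega>. \<Sum>k<n. of_bool (c k \<omega>) * (Y (Suc k) \<omega> - Y k \<omega>))"
    and supermartingale_transform_nonpos: "(\<integral>\<omega>. (\<Sum>k<n. of_bool (c k \<omega>) * (Y (Suc k) \<omega> - Y k \<omega>)) \<partial>M) \<le> 0"
proof -
  have set: "{\<omega> \<in> space M. c k \<omega>} \<in> sets (H k)" for k
    using c[of k] sub[of k] by (auto simp: pred_def subalgebra_def)
  then have setM: "{\<omega> \<in> space M. c k \<omega>} \<in> sets M" for k
    using sub[of k] by (auto simp: subalgebra_def)
  have eq: "indicator {\<omega> \<in> space M. c k \<omega>} \<omega> * (Y (Suc k) \<omega> - Y k \<omega>)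
      = of_bool (c k \<omega>) * (Y (Suc k) \<omega> - Y k \<omega>)" if "\<omega> \<in> space M" for k \<omega>
    using that by (auto simp: indicator_def)
  have int1: "integrable M (\<lambda>\<omega>. of_bool (c k \<omega>) * (Y (Suc k) \<omega> - Y k \<omega>))" for k
  proof -
    have "integrable M (\<lambda>\<omega>. indicator {\<omega> \<in> space M. c k \<omega>} \<omega> * (Y (Suc k) \<omega> - Y k \<omega>))"
      using integrable_mult_indicator[OF setM, of "\<lambda>\<omega>. Y (Suc k) \<omega> - Y k \<omega>"] int by simp
    then show ?thesis by (rule Bochner_Integration.integrable_cong[THEN iffD1, rotated -1]) (use eq in auto)
  qed
  show "integrable M (\<lambda>\<omega>. \<Sum>k<n. of_bool (c k \<omega>) * (Y (Suc k) \<omega> - Y k \<omega>))"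
    by (intro Bochner_Integration.integrable_sum int1)
  have "(\<integral>\<omega>. of_bool (c k \<omega>) * (Y (Suc k) \<omega> - Y k \<omega>) \<partial>M) \<le> 0" for k
  proof -
    have "(\<integral>\<omega>. of_bool (c k \<omega>) * (Y (Suc k) \<omega> - Y k \<omega>) \<partial>M)
        = (\<integral>\<omega>. indicator {\<omega> \<in> space M. c k \<omega>} \<omega> * (Y (Suc k) \<omega> - Y k \<omega>) \<partial>M)"
      by (intro Bochner_Integration.integral_cong refl) (simp add: eq)
    then show ?thesis using decr[OF set[of k]] by simp
  qed
  then show "(\<integral>\<omega>. (\<Sum>k<n. of_bool (c k \<omega>) * (Y (Suc k) \<omega> - Y k \<omega>)) \<partial>M) \<le> 0"
    by (subst Bochner_Integration.integral_sum) (use int1 in \<open>auto intro: sum_nonpos\<close>)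
qed

text \<open>Doob's inequality: the upcrossing strategy has nonpositive expected profit, while every
  upcrossing earns \<open>b - a\<close> and an open position loses at most \<open>R\<close>. Hence
  the expected number of upcrossings before \<open>n\<close> is at most \<open>R / (b - a)\<close>
  for every \<open>n\<close>, and the total number has finite expectation.\<close>

lemma AE_finite_upcrossings:
  assumes lower: "\<And>n. AE \<omega> in M. - L \<le> Y n \<omega>"
    and ab: "a < b"
  shows "AE \<omega> in M. finite {k. upcrossing_at a b (\<lambda>n. Y n \<omega>) k}"
proof -
  let ?c = "\<lambda>n \<omega>. upcrossing_state a b (\<lambda>n. Y n \<omega>) n"
  let ?u = "\<lambda>n \<omega>. upcrossing_at a b (\<lambda>n. Y n \<omega>) n"
  have measn: "Y m \<in> borel_measurable (H n)" if "m \<le> n" for m n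
    using measurable_from_subalg[of "H n" "H m", OF _ meas] mono[OF that] sub
    by (auto simp: subalgebra_def)
  have cn: "Measurable.pred (H n) (?c m)" if "m \<le> n" for m n
    using that
  proof (induction m)
    case 0
    then show ?case using measn[of 0 n] by simp measurable
  next
    case (Suc m)
    then have [measurable]: "Measurable.pred (H n) (?c m)" "Y (Suc m) \<in> borel_measurable (H n)"
      using measn by auto
    show ?case by simp
  qed
  have [measurable]: "Measurable.pred M (?c m)" for m
    using measurable_from_subalg[OF sub cn[of m m]] by simp
  have um [measurable]: "Measurable.pred M (?u m)" for m
    unfolding upcrossing_at_def by measurable
  \<comment> \<open>Bounds the loss on an open position: \<open>Y n - a\<close> is at least
    \<open>- L - a\<close>.\<close>
  define R where "R = \<bar>a\<bar> + \<bar>L\<bar>"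
  have bound: "(\<integral>\<omega>. (\<Sum>k<n. of_bool (?u k \<omega>)) \<partial>M) \<le> R / (b - a)" for n
  proof -
    let ?W = "\<lambda>\<omega>. \<Sum>k<n. of_bool (?c k \<omega>) * (Y (Suc k) \<omega> - Y k \<omega>)"
    have intW: "integrable M ?W" and W: "integral\<^sup>L M ?W \<le> 0"
      by (intro supermartingale_transform_integrable supermartingale_transform_nonpos cn order_refl)+
    have intu: "integrable M (\<lambda>\<omega>. \<Sum>k<n. of_bool (?u k \<omega>) :: real)"
    proof (intro Bochner_Integration.integrable_sum)
      fix k
      show "integrable M (\<lambda>\<omega>. of_bool (?u k \<omega>) :: real)"
        by (rule integrable_const_bound[where B=1]) auto
    qed
    have "AE \<omega> in M. (b - a) * (\<Sum>k<n. of_bool (?u k \<omega>)) - R \<le> ?W \<omega>"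
      using lower[of n]
    proof eventually_elim
      case (elim \<omega>)
      then have "- R \<le> of_bool (?c n \<omega>) * (Y n \<omega> - a)" unfolding R_def by auto
      then show ?case using upcrossing_gain[of a b "\<lambda>n. Y n \<omega>" n] ab by linarith
    qed
    then have "(\<integral>\<omega>. (b - a) * (\<Sum>k<n. of_bool (?u k \<omega>)) - R \<partial>M) \<le> integral\<^sup>L M ?W"
      using intW intu by (intro integral_mono_AE) auto
    then have "(b - a) * (\<integral>\<omega>. (\<Sum>k<n. of_bool (?u k \<omega>)) \<partial>M) - R \<le> 0"
      using W intu by (simp add: prob_space)
    then show ?thesis using ab by (simp add: field_simps)
  qed
  have "(\<integral>\<^sup>+\<omega>. (\<Sum>k. of_bool (?u k \<omega>)) \<partial>M) = (\<Sum>k. \<integral>\<^sup>+\<omega>. of_bool (?u k \<omega>) \<partial>M)"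
    by (rule nn_integral_suminf) auto
  also have "\<dots> \<le> ennreal (R / (b - a))"
  proof (rule suminf_le_const)
    fix n
    have "(\<Sum>k<n. \<integral>\<^sup>+\<omega>. of_bool (?u k \<omega>) \<partial>M) = (\<integral>\<^sup>+\<omega>. (\<Sum>k<n. of_bool (?u k \<omega>)) \<partial>M)"
      by (rule nn_integral_sum[symmetric]) auto
    also have "\<dots> = (\<integral>\<^sup>+\<omega>. ennreal (\<Sum>k<n. of_bool (?u k \<omega>)) \<partial>M)"
      by (simp add: ennreal_of_nat_eq_real_of_nat)
    also have "\<dots> = ennreal (\<integral>\<omega>. (\<Sum>k<n. of_bool (?u k \<omega>)) \<partial>M)"
      by (intro nn_integral_eq_integral Bochner_Integration.integrable_sum
            integrable_const_bound[where B=1]) (auto simp: sum_nonneg)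
    also have "\<dots> \<le> ennreal (R / (b - a))" by (intro ennreal_leI bound)
    finally show "(\<Sum>k<n. \<integral>\<^sup>+\<omega>. of_bool (?u k \<omega>) \<partial>M) \<le> ennreal (R / (b - a))" .
  qed auto
  finally have "(\<integral>\<^sup>+\<omega>. (\<Sum>k. of_bool (?u k \<omega>)) \<partial>M) \<noteq> \<infinity>"
    by (auto simp: top_unique)
  then have "AE \<omega> in M. (\<Sum>k. of_bool (?u k \<omega>)) \<noteq> (\<infinity> :: ennreal)"
    by (intro nn_integral_noteq_infinite) auto
  then show ?thesis
  proof eventually_elim
    case (elim \<omega>)
    show ?case
    proof (rule ccontr)
      let ?I = "{k. ?u k \<omega>}"
      assume inf: "infinite ?I"
      have "of_nat m \<le> (\<Sum>k. of_bool (?u k \<omega>) :: ennreal)" for m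
      proof -
        obtain J where J: "J \<subseteq> ?I" "finite J" "card J = m"
          using infinite_arbitrarily_large[OF inf] by blast
        have "of_nat m = (\<Sum>k\<in>J. of_bool (?u k \<omega>) :: ennreal)"
          using J by (simp add: subset_eq)
        also have "\<dots> \<le> (\<Sum>k. of_bool (?u k \<omega>))"
          using J by (intro sum_le_suminf) auto
        finally show ?thesis .
      qed
      then show False using elim
        by (metis ennreal_of_nat_eq_real_of_nat infinity_ennreal_def less_top not_le ennreal_Ex_less_of_nat)
    qed
  qed
qed

text \<open>One application of Fatou's lemma to the nonnegative \<open>Y n + L\<close> serves both
  claims: finiteness of the liminf excludes divergence to infinity once the upcrossings are finite,
  and the liminf then equals the limit in the integral bound.\<close>

lemma
  assumes lower: "\<And>n. AE \<omega> in M. - L \<le> Y n \<omega>"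
  shows AE_convergent: "AE \<omega> in M. convergent (\<lambda>n. Y n \<omega>)"
    and nn_integral_lim_le: "(\<integral>\<^sup>+\<omega>. ennreal (lim (\<lambda>n. Y n \<omega>) + L) \<partial>M) \<le> ennreal ((\<integral>\<omega>. Y 0 \<omega> \<partial>M) + L)"
proof -
  have YM [measurable]: "Y n \<in> borel_measurable M" for n using int by auto
  have EY: "integral\<^sup>L M (Y n) \<le> integral\<^sup>L M (Y 0)" for n
  proof (induction n)
    case (Suc n)
    have "space M \<in> sets (H n)" using sub[of n] by (metis sets.top subalgebra_def)
    from decr[OF this] have "(\<integral>\<omega>. Y (Suc n) \<omega> - Y n \<omega> \<partial>M) \<le> 0"
      by (subst (asm) Bochner_Integration.integral_cong[OF refl, of M _ "\<lambda>\<omega>. Y (Suc n) \<omega> - Y n \<omega>"]) auto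
    then show ?case using Suc int by simp
  qed simp
  have lowerall: "AE \<omega> in M. \<forall>n. - L \<le> Y n \<omega>" using lower by (simp add: AE_all_countable)
  have "(\<integral>\<^sup>+\<omega>. liminf (\<lambda>n. ennreal (Y n \<omega> + L)) \<partial>M)
      \<le> liminf (\<lambda>n. \<integral>\<^sup>+\<omega>. ennreal (Y n \<omega> + L) \<partial>M)"
    by (rule nn_integral_liminf) auto
  also have "\<dots> \<le> ennreal (integral\<^sup>L M (Y 0) + L)"
  proof -
    have "(\<integral>\<^sup>+\<omega>. ennreal (Y n \<omega> + L) \<partial>M) \<le> ennreal (integral\<^sup>L M (Y 0) + L)" for n
    proof -
      have "(\<integral>\<^sup>+\<omega>. ennreal (Y n \<omega> + L) \<partial>M) = ennreal (\<integral>\<omega>. Y n \<omega> + L \<partial>M)"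
        using lower[of n] int by (intro nn_integral_eq_integral) (auto elim!: eventually_mono)
      also have "\<dots> \<le> ennreal (integral\<^sup>L M (Y 0) + L)"
        using EY[of n] int by (intro ennreal_leI) (simp add: prob_space)
      finally show ?thesis .
    qed
    then show ?thesis
      by (intro order_trans[OF Liminf_le_Limsup Limsup_bounded]) auto
  qed
  finally have fatou: "(\<integral>\<^sup>+\<omega>. liminf (\<lambda>n. ennreal (Y n \<omega> + L)) \<partial>M) \<le> ennreal (integral\<^sup>L M (Y 0) + L)" .
  then have "(\<integral>\<^sup>+\<omega>. liminf (\<lambda>n. ennreal (Y n \<omega> + L)) \<partial>M) \<noteq> \<infinity>" by (auto simp: top_unique)
  then have fin: "AE \<omega> in M. liminf (\<lambda>n. ennreal (Y n \<omega> + L)) \<noteq> \<infinity>"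
    by (intro nn_integral_noteq_infinite) auto
  have "AE \<omega> in M. \<forall>a\<in>\<rat>. \<forall>b\<in>\<rat>. a < b \<longrightarrow> finite {k. upcrossing_at a b (\<lambda>n. Y n \<omega>) k}"
    using AE_finite_upcrossings[OF lower]
    by (simp add: AE_ball_countable countable_rat)
  then show conv: "AE \<omega> in M. convergent (\<lambda>n. Y n \<omega>)"
    using fin lowerall
  proof eventually_elim
    case (elim \<omega>)
    let ?y = "\<lambda>n. ereal (Y n \<omega>)"
    have eq: "liminf ?y = limsup ?y"
      using elim(1) by (intro Liminf_eq_Limsup_if_finite_upcrossings) auto
    have "ereal (- L) \<le> liminf ?y" using elim by (intro Liminf_bounded) auto
    moreover have "liminf ?y \<noteq> \<infinity>"
    proof
      assume "liminf ?y = \<infinity>"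
      then have "?y \<longlonglongrightarrow> \<infinity>" using eq by (simp add: tendsto_iff_Liminf_eq_Limsup)
      then have "filterlim (\<lambda>n. Y n \<omega>) at_top sequentially" 
        by (simp add: tendsto_PInfty_eq_at_top)
      then have "filterlim (\<lambda>n. Y n \<omega> + L) at_top sequentially" 
        by (subst add.commute) (rule filterlim_tendsto_add_at_top[OF tendsto_const])
      then have "((\<lambda>n. ennreal (Y n \<omega> + L)) \<longlonglongrightarrow> top)"
        by (rule filterlim_compose[OF ennreal_tendsto_top_eq_at_top[THEN iffD2, OF filterlim_ident], unfolded o_def])
      then show False using elim lim_imp_Liminf[of sequentially "\<lambda>n. ennreal (Y n \<omega> + L)" top] by simp
    qed
    ultimately obtain l where "liminf ?y = ereal l" by (cases "liminf ?y") auto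
    then have "(\<lambda>n. Y n \<omega>) \<longlonglongrightarrow> l" using eq by (intro limsup_le_liminf_real) auto
    then show ?case by (auto simp: convergent_def)
  qed
  have "(\<integral>\<^sup>+\<omega>. ennreal (lim (\<lambda>n. Y n \<omega>) + L) \<partial>M) = (\<integral>\<^sup>+\<omega>. liminf (\<lambda>n. ennreal (Y n \<omega> + L)) \<partial>M)"
  proof (rule nn_integral_cong_AE)
    show "AE \<omega> in M. ennreal (lim (\<lambda>n. Y n \<omega>) + L) = liminf (\<lambda>n. ennreal (Y n \<omega> + L))"
      using conv
    proof eventually_elim
      case (elim \<omega>)
      then have "(\<lambda>n. Y n \<omega>) \<longlonglongrightarrow> lim (\<lambda>n. Y n \<omega>)" by (simp add: convergent_LIMSEQ_iff)
      then have "(\<lambda>n. ennreal (Y n \<omega> + L)) \<longlonglongrightarrow> ennreal (lim (\<lambda>n. Y n \<omega>) + L)"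
        by (intro tendsto_ennrealI tendsto_intros)
      then show ?case by (simp add: lim_imp_Liminf)
    qed
  qed
  then show "(\<integral>\<^sup>+\<omega>. ennreal (lim (\<lambda>n. Y n \<omega>) + L) \<partial>M) \<le> ennreal ((\<integral>\<omega>. Y 0 \<omega> \<partial>M) + L)"
    using fatou by simp
qed

end

section \<open>The stopped process along a path\<close>

definition lyapunov :: "(nat \<Rightarrow> real) \<Rightarrow> (nat \<Rightarrow> real) \<Rightarrow> nat \<Rightarrow> real" where
  "lyapunov a x n = (1 + a n) * x (Suc n) - a n * x n"

text \<open>The added sum offsets the drift in the Robbins-Siegmund inequality for the Lyapunov
  function. The factor \<open>1 + a (Suc k)\<close> is the coefficient with which
  \<open>x (Suc (Suc k))\<close>, and hence the recursion at time \<open>k\<close>, enters the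
  increment.\<close>

definition compensated ::
  "(nat \<Rightarrow> real) \<Rightarrow> (nat \<Rightarrow> real) \<Rightarrow> (nat \<Rightarrow> real) \<Rightarrow> (nat \<Rightarrow> real) \<Rightarrow> nat \<Rightarrow> real" where
  "compensated a x \<eta> \<gamma> n = lyapunov a x n + (\<Sum>k<n. (1 + a (Suc k)) * (\<eta> k - \<gamma> k))"

text \<open>The bound m controls the initial values and the sum of the perturbations; the level K is
  sent to infinity later while m stays fixed. Note that the condition at time n involves
  x (Suc n), so at the exit time N still x N \<open>\<le>\<close> K holds, while x (Suc N) may be arbitrarily large.\<close>

definition running :: "real \<Rightarrow> real \<Rightarrow> (nat \<Rightarrow> real) \<Rightarrow> (nat \<Rightarrow> real) \<Rightarrow> nat \<Rightarrow> bool" where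
  "running m K x \<gamma> n \<longleftrightarrow>
     x 0 \<le> m \<and> x 1 \<le> m \<and> (\<forall>k\<le>Suc n. x k \<le> K) \<and> (\<Sum>k\<le>n. \<gamma> k) \<le> m"

text \<open>Stopping is encoded as a sum of increments switched on by an indicator known at time
  \<open>k\<close>, so that no random time occurs. The indicator on the initial term makes the
  process bounded at time 0.\<close>

definition stopped ::
  "(nat \<Rightarrow> real) \<Rightarrow> real \<Rightarrow> real \<Rightarrow> (nat \<Rightarrow> real) \<Rightarrow> (nat \<Rightarrow> real) \<Rightarrow> (nat \<Rightarrow> real) \<Rightarrow> nat \<Rightarrow> real" where
  "stopped a m K x \<eta> \<gamma> n =
     of_bool (x 0 \<le> m \<and> x 1 \<le> m) * lyapunov a x 0
     + (\<Sum>k<n. of_bool (running m K x \<gamma> k)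
          * (compensated a x \<eta> \<gamma> (Suc k) - compensated a x \<eta> \<gamma> k))"

text \<open>At an exit caused by the perturbations, the Lyapunov function can be as negative as a
  multiple of this value, which does not depend on K.\<close>

definition exceedance_value :: "real \<Rightarrow> (nat \<Rightarrow> real) \<Rightarrow> (nat \<Rightarrow> real) \<Rightarrow> real" where
  "exceedance_value m x \<gamma> =
     (if \<exists>p. m < (\<Sum>k\<le>p. \<gamma> k) then x (LEAST p. m < (\<Sum>k\<le>p. \<gamma> k)) else 0)"

lemma summable_suminf_le_if_bounded:
  fixes f :: "nat \<Rightarrow> real"
  assumes "\<And>n. 0 \<le> f n" "\<And>n. (\<Sum>k<n. f k) \<le> B"
  shows "summable f" "suminf f \<le> B"
  using summableI_nonneg_bounded[of f B] suminf_le_const[of f B] assms by auto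

locale inertial_path =
  fixes a x \<eta> \<gamma> :: "nat \<Rightarrow> real" and C m K :: real
  assumes a: "\<And>n. 0 \<le> a n" "\<And>n. a n \<le> C"
    and x: "\<And>n. 0 \<le> x n" and \<eta>: "\<And>n. 0 \<le> \<eta> n" and \<gamma>: "\<And>n. 0 \<le> \<gamma> n"
    and m: "0 \<le> m" "m \<le> K"
begin

abbreviation "V \<equiv> lyapunov a x"
abbreviation "T \<equiv> compensated a x \<eta> \<gamma>"
abbreviation "S \<equiv> stopped a m K x \<eta> \<gamma>"
abbreviation "R \<equiv> running m K x \<gamma>"
abbreviation "start \<equiv> x 0 \<le> m \<and> x 1 \<le> m"

lemma C: "0 \<le> C" using a[of 0] by linarith

lemma running_start: "R n \<Longrightarrow> start" by (simp add: running_def)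

lemma stopped_not_start: "\<not> start \<Longrightarrow> S n = 0"
  unfolding stopped_def using running_start by (auto intro!: sum.neutral)

lemma running_mono: "R n \<Longrightarrow> k \<le> n \<Longrightarrow> R k"
  unfolding running_def using sum_mono2[of "{..n}" "{..k}" \<gamma>] \<gamma> by force

lemma stopped_0: "start \<Longrightarrow> S 0 = T 0"
  by (simp add: stopped_def compensated_def)

lemma stopped_Suc: "S (Suc n) = S n + of_bool (R n) * (T (Suc n) - T n)"
  by (simp add: stopped_def)

lemma stopped_running: "start \<Longrightarrow> (\<And>k. k < n \<Longrightarrow> R k) \<Longrightarrow> S n = T n"
  by (induction n) (simp_all add: stopped_0 stopped_Suc)

lemma stopped_exit:
  assumes "start" "\<And>k. k < N \<Longrightarrow> R k" "\<not> R N"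
  shows "S n = T (min n N)"
proof (cases "n \<le> N")
  case True
  then show ?thesis using assms stopped_running[of n] by (simp add: min_def)
next
  case False
  then have "N \<le> n" by simp
  then have "S n = T N"
  proof (induction n rule: dec_induct)
    case (step n)
    then have "\<not> R n" using running_mono assms(3) by blast
    then show ?case using step by (simp add: stopped_Suc)
  qed (use assms stopped_running in auto)
  then show ?thesis using False by simp
qed

lemma sum_weighted_le: "(\<Sum>k<n. \<gamma> k) \<le> m \<Longrightarrow> (\<Sum>k<n. (1 + a (Suc k)) * \<gamma> k) \<le> (1 + C) * m"
proof -
  assume *: "(\<Sum>k<n. \<gamma> k) \<le> m"
  have "(\<Sum>k<n. (1 + a (Suc k)) * \<gamma> k) \<le> (\<Sum>k<n. (1 + C) * \<gamma> k)"
    using a \<gamma> by (intro sum_mono mult_right_mono) auto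
  also have "\<dots> = (1 + C) * (\<Sum>k<n. \<gamma> k)" by (simp add: sum_distrib_left)
  also have "\<dots> \<le> (1 + C) * m" using * C by (intro mult_left_mono) auto
  finally show ?thesis .
qed

lemma compensated_eq:
  "T n = V n + (\<Sum>k<n. (1 + a (Suc k)) * \<eta> k) - (\<Sum>k<n. (1 + a (Suc k)) * \<gamma> k)"
  by (simp add: compensated_def right_diff_distrib sum_subtractf)

lemma sum_\<gamma>_le:
  assumes "\<And>k. k < n \<Longrightarrow> R k"
  shows "(\<Sum>k<n. \<gamma> k) \<le> m"
proof (cases n)
  case (Suc i)
  then have "R i" using assms by simp
  then show ?thesis by (simp add: running_def Suc lessThan_Suc_atMost)
qed (use m in simp)

lemma compensated_ge:
  assumes "\<And>k. k < n \<Longrightarrow> R k"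
  shows "V n - (1 + C) * m \<le> T n"
proof -
  have "0 \<le> (\<Sum>k<n. (1 + a (Suc k)) * \<eta> k)"
    using a \<eta> by (intro sum_nonneg mult_nonneg_nonneg) auto
  moreover have "(\<Sum>k<n. (1 + a (Suc k)) * \<gamma> k) \<le> (1 + C) * m"
    by (intro sum_weighted_le sum_\<gamma>_le assms)
  ultimately show ?thesis by (simp add: compensated_eq)
qed

lemma x_le_K:
  assumes "start" "\<And>k. k < n \<Longrightarrow> R k"
  shows "x n \<le> K"
proof (cases n)
  case 0
  then show ?thesis using assms m by simp
next
  case (Suc i)
  then have "R i" using assms by simp
  then show ?thesis using Suc by (simp add: running_def)
qed

lemma lyapunov_ge: "- (C * x n) \<le> V n"
proof -
  have "a n * x n \<le> C * x n" "0 \<le> (1 + a n) * x (Suc n)"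
    using a[of n] x by (auto intro: mult_right_mono)
  then show ?thesis unfolding lyapunov_def by linarith
qed

section \<open>Lower bounds and limits of the stopped path\<close>

lemma stopped_cases:
  obtains (no_start) "\<not> start"
  | (exit) N where "start" "\<And>k. k < N \<Longrightarrow> R k" "\<not> R N" "\<And>n. S n = T (min n N)"
  | (forever) "start" "\<And>k. R k" "\<And>n. S n = T n"
proof (cases "start")
  case True
  show ?thesis
  proof (cases "\<forall>k. R k")
    case True
    show ?thesis
      by (rule forever) (use True \<open>start\<close> stopped_running in auto)
  next
    case False
    define N where "N = (LEAST k. \<not> R k)"
    have N: "\<not> R N" "\<And>k. k < N \<Longrightarrow> R k"
      using False LeastI_ex[of "\<lambda>k. \<not> R k"] not_less_Least[where P="\<lambda>k. \<not> R k"]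
      unfolding N_def by blast+
    show ?thesis
      by (rule exit[of N, OF \<open>start\<close> N(2,1) stopped_exit[OF \<open>start\<close> N(2,1)]])
  qed
qed (use no_start in blast)

text \<open>Up to and including the exit time, \<open>x\<close> is at most \<open>K\<close>, which
  costs \<open>C * K\<close> in the Lyapunov function. The compensator at that time contains only
  perturbations from strictly earlier times, whose sum is at most \<open>m\<close>; they cost
  \<open>(1 + C) * m\<close>, and the \<open>\<eta>\<close> terms only help.\<close>

lemma stopped_ge: "- (C * K + (1 + C) * m) \<le> S n"
proof -
  have *: "- (C * K + (1 + C) * m) \<le> T j" if "start" "\<And>k. k < j \<Longrightarrow> R k" for j
  proof -
    have "C * x j \<le> C * K" using x_le_K[OF that] C by (intro mult_left_mono) auto
    then show ?thesis using compensated_ge[OF that(2)] lyapunov_ge[of j] by fastforce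
  qed
  show ?thesis
  proof (cases rule: stopped_cases)
    case no_start
    have "0 \<le> C * K + (1 + C) * m" using C m by (intro add_nonneg_nonneg mult_nonneg_nonneg) auto
    then show ?thesis using stopped_not_start[OF no_start] by simp
  next
    case (exit N)
    then show ?thesis using *[of "min n N"] by simp
  next
    case forever
    then show ?thesis using *[of n] by simp
  qed
qed

text \<open>As \<open>S\<close> is bounded and the Lyapunov function is bounded below, the weighted
  sums of \<open>\<eta>\<close> are bounded. So both compensating series converge, hence
  \<open>V\<close> does, and \<open>inertial_tendsto\<close> carries this over to \<open>x\<close>.
  The bound on \<open>l\<close> follows because the limit of \<open>x\<close> is
  nonnegative.\<close>

lemma forever_convergent:
  assumes run: "\<And>k. R k" and l: "S \<longlonglongrightarrow> l"
  shows "convergent x" "summable \<eta>" "- ((1 + C) * m) \<le> l"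
proof -
  have start: start using run[of 0] by (rule running_start)
  have ST: "S n = T n" for n using stopped_running[OF start run] by simp
  let ?g = "\<lambda>k. (1 + a (Suc k)) * \<gamma> k" and ?e = "\<lambda>k. (1 + a (Suc k)) * \<eta> k"
  have g0: "0 \<le> ?g k" and e0: "0 \<le> ?e k" for k
    using a \<gamma> \<eta> by (auto intro!: mult_nonneg_nonneg)
  have gle: "(\<Sum>k<n. ?g k) \<le> (1 + C) * m" for n
    by (rule sum_weighted_le[OF sum_\<gamma>_le[OF run]])
  note g = summable_suminf_le_if_bounded[of ?g, OF g0 gle]
  have xK: "x n \<le> K" for n using x_le_K[OF start run] .
  obtain B where B: "\<And>n. \<bar>S n\<bar> \<le> B"
    using convergent_imp_Bseq[of S] l by (auto simp: convergent_def Bseq_def)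
  have ele: "(\<Sum>k<n. ?e k) \<le> B + (1 + C) * m + C * K" for n
  proof -
    have "C * x n \<le> C * K" using xK[of n] C by (intro mult_left_mono) auto
    moreover have "(\<Sum>k<n. ?e k) = S n - V n + (\<Sum>k<n. ?g k)"
      by (simp add: ST compensated_eq)
    ultimately show ?thesis using B[of n] gle[of n] lyapunov_ge[of n] by linarith
  qed
  note e = summable_suminf_le_if_bounded[of ?e, OF e0 ele]
  show "summable \<eta>"
  proof (rule summable_comparison_test'[OF e(1), of 0])
    show "norm (\<eta> n) \<le> ?e n" for n
      using a[of "Suc n"] \<eta>[of n] by (simp add: algebra_simps)
  qed
  have "(\<lambda>n. S n - (\<Sum>k<n. ?e k) + (\<Sum>k<n. ?g k)) \<longlonglongrightarrow> l - suminf ?e + suminf ?g"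
    using e(1) g(1) by (intro tendsto_intros l summable_LIMSEQ)
  then have "V \<longlonglongrightarrow> l - suminf ?e + suminf ?g"
    by (simp add: ST compensated_eq)
  then have lim: "x \<longlonglongrightarrow> l - suminf ?e + suminf ?g"
    by (rule inertial_tendsto[OF a, where V=V and B=K, rotated -1])
       (simp_all add: lyapunov_def x xK)
  then show "convergent x" by (auto simp: convergent_def)
  have "0 \<le> l - suminf ?e + suminf ?g"
    using lim x by (intro LIMSEQ_le_const) auto
  moreover have "0 \<le> suminf ?e" using e e0 by (intro suminf_nonneg) auto
  ultimately show "- ((1 + C) * m) \<le> l" using g(2) by linarith
qed

text \<open>A path satisfying the condition under \<open>of_bool\<close> is unbounded with
  perturbations at most \<open>m\<close>, so it can only exit by exceeding \<open>K\<close>, which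
  leaves the Lyapunov function at least \<open>K\<close>. An exit through the perturbations happens
  at the time that defines \<open>exceedance_value\<close>, where \<open>x N \<le> K\<close> still
  holds; this explains the minimum.\<close>

lemma limit_stopped_ge:
  assumes l: "S \<longlonglongrightarrow> l"
  shows "K * of_bool (start \<and> (\<forall>n. (\<Sum>k\<le>n. \<gamma> k) \<le> m) \<and> \<not> (\<exists>B::nat. \<forall>n. x n \<le> real B))
      - (1 + C) * m - C * min K (exceedance_value m x \<gamma>) \<le> l"
    (is "K * of_bool ?D - _ - C * min K ?g \<le> l")
proof -
  define D where "D \<longleftrightarrow> ?D"
  have g: "0 \<le> ?g" using x by (simp add: exceedance_value_def)
  have K: "0 \<le> K" using m by simp
  have Cg: "0 \<le> C * min K ?g" using C K g by simp
  have Cm: "0 \<le> (1 + C) * m" using C m by simp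
  have "K * of_bool D - (1 + C) * m - C * min K ?g \<le> l"
  proof (cases rule: stopped_cases)
    case no_start
    have "S = (\<lambda>_. 0)" using stopped_not_start[OF no_start] by (intro ext)
    then have "l = 0" using LIMSEQ_unique[OF l, of 0] by simp
    moreover have "\<not> D" using no_start unfolding D_def by blast
    ultimately show ?thesis using Cg Cm by simp
  next
    case forever
    obtain B :: nat where "K \<le> real B" using real_arch_simple by blast
    moreover have "x n \<le> K" for n using x_le_K[OF forever(1,2)] .
    ultimately have "\<forall>n. x n \<le> real B" by (meson order_trans)
    then have "\<not> D" unfolding D_def by blast
    then show ?thesis using forever_convergent(3)[OF forever(2) l] Cg by simp
  next
    case (exit N)
    have "S \<longlonglongrightarrow> T N"
      by (rule tendsto_eventually) (auto simp: exit(4) eventually_sequentially intro!: exI[of _ N])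
    then have lT: "l = T N" using l LIMSEQ_unique by blast
    have xN: "x N \<le> K" using exit x_le_K by simp
    have VT: "V N - (1 + C) * m \<le> l" using compensated_ge[of N] exit lT by simp
    have xk: "x k \<le> K" if "k \<le> N" for k
      using x_le_K[OF exit(1), of k] exit(2) that by simp
    show ?thesis
    proof (cases "x (Suc N) \<le> K")
      case True
      \<comment> \<open>All values up to \<open>x (Suc N)\<close> respect \<open>K\<close> and the
        start condition holds, so only the perturbations can have ended the run.\<close>
      then have gt: "m < (\<Sum>k\<le>N. \<gamma> k)"
        using exit xk unfolding running_def by (auto simp: le_Suc_eq)
      have "(LEAST p. m < (\<Sum>k\<le>p. \<gamma> k)) = N"
      proof (rule Least_equality)
        fix p assume "m < (\<Sum>k\<le>p. \<gamma> k)"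
        then have "\<not> R p" by (simp add: running_def)
        then show "N \<le> p" using exit(2) by (meson not_less)
      qed (fact gt)
      then have "?g = x N" using gt by (auto simp: exceedance_value_def)
      moreover have "\<not> D" using gt unfolding D_def by (auto simp: not_le)
      ultimately show ?thesis using VT lyapunov_ge[of N] xN by (simp add: min_def)
    next
      case False
      \<comment> \<open>The two coefficients in \<open>V N\<close> differ by exactly 1, so
        \<open>x (Suc N) > K\<close> and \<open>x N \<le> K\<close> give \<open>V N \<ge> K\<close>
        whatever the weight is.\<close>
      have "K = (1 + a N) * K - a N * K" by (simp add: algebra_simps)
      also have "\<dots> \<le> V N"
        unfolding lyapunov_def using False xN a[of N]
        by (intro diff_mono mult_left_mono) auto
      finally have "K * of_bool D \<le> V N" using K by auto
      then show ?thesis using VT Cg by linarith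
    qed
  qed
  then show ?thesis by (simp only: D_def)
qed

end

section \<open>Almost sure convergence of inertial processes\<close>

text \<open>The filtration runs one step ahead of the sequence: \<open>x (Suc n)\<close> is already
  known to \<open>H n\<close>, which makes the Lyapunov function at \<open>n\<close> adapted. No
  integrability of \<open>x\<close> is assumed.\<close>

locale inertial_process = prob_space M for M :: "'a measure" +
  fixes H :: "nat \<Rightarrow> 'a measure" and x \<eta> \<gamma> :: "nat \<Rightarrow> 'a \<Rightarrow> real"
    and \<theta> a :: "nat \<Rightarrow> real" and C :: real
  assumes sub: "\<And>n. subalgebra M (H n)"
    and mono: "\<And>m n. m \<le> n \<Longrightarrow> sets (H m) \<subseteq> sets (H n)"
    and x_adapted: "\<And>n. x n \<in> borel_measurable (H n)" "\<And>n. x (Suc n) \<in> borel_measurable (H n)"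
    and \<eta>_adapted: "\<And>n. \<eta> n \<in> borel_measurable (H n)"
    and \<gamma>_adapted: "\<And>n. \<gamma> n \<in> borel_measurable (H n)"
    and x_nonneg: "\<And>n. AE \<omega> in M. 0 \<le> x n \<omega>"
    and \<eta>_nonneg: "\<And>n. AE \<omega> in M. 0 \<le> \<eta> n \<omega>"
    and \<gamma>_nonneg: "\<And>n. AE \<omega> in M. 0 \<le> \<gamma> n \<omega>"
    and \<theta>_nonneg: "\<And>n. 0 \<le> \<theta> n"
    and a_rec: "\<And>n. a n = \<theta> n * (1 + a (Suc n))"
    and a_bounds: "\<And>n. 0 \<le> a n" "\<And>n. a n \<le> C"
    and recursion: "\<And>n. AE \<omega> in M. nonneg_cond_exp M (H n) (x (Suc (Suc n))) \<omega>
        \<le> ereal ((1 + \<theta> n) * x (Suc n) \<omega> - \<theta> n * x n \<omega> - \<eta> n \<omega> + \<gamma> n \<omega>)"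
begin

definition rhs :: "nat \<Rightarrow> 'a \<Rightarrow> real" where
  "rhs n \<omega> = (1 + \<theta> n) * x (Suc n) \<omega> - \<theta> n * x n \<omega> - \<eta> n \<omega> + \<gamma> n \<omega>"

abbreviation "R m K n \<omega> \<equiv> running m K (\<lambda>n. x n \<omega>) (\<lambda>n. \<gamma> n \<omega>) n"
abbreviation "T n \<omega> \<equiv> compensated a (\<lambda>n. x n \<omega>) (\<lambda>n. \<eta> n \<omega>) (\<lambda>n. \<gamma> n \<omega>) n"
abbreviation "S m K n \<omega> \<equiv> stopped a m K (\<lambda>n. x n \<omega>) (\<lambda>n. \<eta> n \<omega>) (\<lambda>n. \<gamma> n \<omega>) n"

section \<open>Adaptedness of the stopped process\<close>

lemma measurable_H_le:
  assumes "f \<in> borel_measurable (H m)" "m \<le> n"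
  shows "f \<in> borel_measurable (H n)"
proof -
  have "subalgebra (H n) (H m)"
    using sub[of n] sub[of m] mono[OF assms(2)] by (auto simp: subalgebra_def)
  then show ?thesis using assms(1) by (rule measurable_from_subalg)
qed

lemma adapted:
  "k \<le> Suc n \<Longrightarrow> x k \<in> borel_measurable (H n)"
  "k \<le> n \<Longrightarrow> \<eta> k \<in> borel_measurable (H n)"
  "k \<le> n \<Longrightarrow> \<gamma> k \<in> borel_measurable (H n)"
proof -
  show "x k \<in> borel_measurable (H n)" if "k \<le> Suc n"
  proof (cases "k \<le> n")
    case False
    then have "k = Suc n" using that by simp
    then show ?thesis using x_adapted(2) by simp
  qed (use x_adapted(1) measurable_H_le in blast)
qed (use \<eta>_adapted \<gamma>_adapted measurable_H_le in blast)+

lemma measurable_M [measurable]: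
  "x n \<in> borel_measurable M" "\<eta> n \<in> borel_measurable M" "\<gamma> n \<in> borel_measurable M"
  by (rule measurable_from_subalg[OF sub x_adapted(1)] measurable_from_subalg[OF sub \<eta>_adapted]
      measurable_from_subalg[OF sub \<gamma>_adapted])+

lemma running_measurable: "k \<le> n \<Longrightarrow> Measurable.pred (H n) (R m K k)"
proof -
  assume k: "k \<le> n"
  have "\<And>i. i \<le> Suc k \<Longrightarrow> x i \<in> borel_measurable (H n)" "\<And>i. i \<le> k \<Longrightarrow> \<gamma> i \<in> borel_measurable (H n)"
    using k adapted by auto
  note [measurable] = this(1)[of 0] this(1)[of 1, simplified] this
  have [measurable]: "(\<lambda>\<omega>. \<Sum>i\<le>k. \<gamma> i \<omega>) \<in> borel_measurable (H n)"
    by (rule borel_measurable_sum) auto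
  have [measurable]: "Measurable.pred (H n) (\<lambda>\<omega>. \<forall>i\<in>{..Suc k}. x i \<omega> \<le> K)"
    by (rule pred_intros_finite) auto
  have "R m K k = (\<lambda>\<omega>. x 0 \<omega> \<le> m \<and> x 1 \<omega> \<le> m \<and> (\<forall>i\<in>{..Suc k}. x i \<omega> \<le> K) \<and> (\<Sum>i\<le>k. \<gamma> i \<omega>) \<le> m)"
    by (auto simp: running_def fun_eq_iff)
  then show ?thesis by simp
qed

lemma compensated_measurable: "k \<le> n \<Longrightarrow> T k \<in> borel_measurable (H n)"
proof -
  assume k: "k \<le> n"
  have [measurable]: "x k \<in> borel_measurable (H n)" "x (Suc k) \<in> borel_measurable (H n)"
    using k adapted by auto
  have [measurable]: "(\<lambda>\<omega>. \<Sum>i<k. (1 + a (Suc i)) * (\<eta> i \<omega> - \<gamma> i \<omega>)) \<in> borel_measurable (H n)"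
    using k adapted by (intro borel_measurable_sum borel_measurable_times borel_measurable_diff) auto
  show ?thesis unfolding compensated_def lyapunov_def by measurable
qed

text \<open>The purpose of the weights: the increment subtracts \<open>1 + a n + a (Suc n)\<close>
  times \<open>x (Suc n)\<close> and adds \<open>a n\<close> times \<open>x n\<close>, and by
  \<open>a_rec\<close> these are \<open>1 + a (Suc n)\<close> times the coefficients
  \<open>1 + \<theta> n\<close> and \<open>\<theta> n\<close> in \<open>rhs n\<close>.\<close>

lemma stopped_Suc_diff:
  "S m K (Suc n) \<omega> - S m K n \<omega>
   = (1 + a (Suc n)) * (of_bool (R m K n \<omega>) * (x (Suc (Suc n)) \<omega> - rhs n \<omega>))"
proof -
  have "T (Suc n) \<omega> - T n \<omega> = (1 + a (Suc n)) * (x (Suc (Suc n)) \<omega> - rhs n \<omega>)"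
    by (simp add: compensated_def lyapunov_def rhs_def a_rec[of n] algebra_simps)
  then show ?thesis by (simp add: stopped_def)
qed

lemma start_measurable: "Measurable.pred (H n) (\<lambda>\<omega>. x 0 \<omega> \<le> m \<and> x 1 \<omega> \<le> m)"
proof -
  have [measurable]: "x 0 \<in> borel_measurable (H n)" "x (Suc 0) \<in> borel_measurable (H n)"
    by (auto intro: adapted)
  show ?thesis by simp
qed

lemma stopped_measurable: "S m K n \<in> borel_measurable (H n)"
proof -
  have [measurable]: "(\<lambda>\<omega>. \<Sum>k<n. of_bool (R m K k \<omega>) * (T (Suc k) \<omega> - T k \<omega>)) \<in> borel_measurable (H n)"
  proof (intro borel_measurable_sum)
    fix k assume "k \<in> {..<n}"
    then have [measurable]: "Measurable.pred (H n) (R m K k)" "T (Suc k) \<in> borel_measurable (H n)"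
      "T k \<in> borel_measurable (H n)"
      using running_measurable compensated_measurable by auto
    show "(\<lambda>\<omega>. of_bool (R m K k \<omega>) * (T (Suc k) \<omega> - T k \<omega>)) \<in> borel_measurable (H n)" by measurable
  qed
  have [measurable]: "x 0 \<in> borel_measurable (H n)" "x (Suc 0) \<in> borel_measurable (H n)"
    by (auto intro: adapted)
  note start_measurable[measurable]
  show ?thesis unfolding stopped_def lyapunov_def by measurable
qed

lemma rhs_measurable: "rhs n \<in> borel_measurable (H n)"
proof -
  note adapted[measurable]
  have [measurable]: "x n \<in> borel_measurable (H n)" "x (Suc n) \<in> borel_measurable (H n)"
    "\<eta> n \<in> borel_measurable (H n)" "\<gamma> n \<in> borel_measurable (H n)" by (auto intro: adapted)
  show ?thesis unfolding rhs_def by measurable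
qed

lemma rhs_measurable_M [measurable]: "rhs n \<in> borel_measurable M"
  using rhs_measurable measurable_from_subalg[OF sub] by blast

section \<open>From the recursion to a supermartingale\<close>

lemma running_rhs_le:
  assumes "R m K n \<omega>" "\<And>n. 0 \<le> x n \<omega>" "\<And>n. 0 \<le> \<eta> n \<omega>" "\<And>n. 0 \<le> \<gamma> n \<omega>"
  shows "rhs n \<omega> \<le> (1 + \<theta> n) * K + m"
proof -
  have "x (Suc n) \<omega> \<le> K" "(\<Sum>k\<le>n. \<gamma> k \<omega>) \<le> m" using assms(1) by (auto simp: running_def)
  moreover have "\<gamma> n \<omega> \<le> (\<Sum>k\<le>n. \<gamma> k \<omega>)"
    using assms(4) by (intro member_le_sum) auto
  moreover have "(1 + \<theta> n) * x (Suc n) \<omega> \<le> (1 + \<theta> n) * K"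
    using calculation(1) \<theta>_nonneg[of n] by (intro mult_left_mono) auto
  moreover have "0 \<le> \<theta> n * x n \<omega>" using assms(2)[of n] \<theta>_nonneg[of n] by simp
  ultimately show ?thesis using assms(3)[of n] unfolding rhs_def by linarith
qed

lemma AE_nonneg: "AE \<omega> in M. \<forall>n. 0 \<le> x n \<omega> \<and> 0 \<le> \<eta> n \<omega> \<and> 0 \<le> \<gamma> n \<omega>"
  using x_nonneg \<eta>_nonneg \<gamma>_nonneg by (simp add: AE_all_countable)

text \<open>The conditional expectation is nonnegative, so the recursion itself forces
  \<open>rhs n\<close> to be nonnegative; the inequality then passes from \<open>ereal\<close> to
  \<open>ennreal\<close> without loss.\<close>

lemma AE_cond_exp_le:
  "AE \<omega> in M. 0 \<le> rhs n \<omega> \<and>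
     nn_cond_exp M (H n) (\<lambda>\<omega>. ennreal (x (Suc (Suc n)) \<omega>)) \<omega> \<le> ennreal (rhs n \<omega>)"
  using recursion[of n]
proof eventually_elim
  case (elim \<omega>)
  let ?e = "nn_cond_exp M (H n) (\<lambda>\<omega>. ennreal (x (Suc (Suc n)) \<omega>)) \<omega>"
  have le: "enn2ereal ?e \<le> ereal (rhs n \<omega>)"
    using elim by (simp add: nonneg_cond_exp_def rhs_def)
  then have "0 \<le> ereal (rhs n \<omega>)" using enn2ereal_nonneg order_trans by blast
  then have "0 \<le> rhs n \<omega>" by simp
  then show ?case using le by (simp add: less_eq_ennreal.rep_eq enn2ereal_ennreal)
qed

text \<open>While the process runs, \<open>rhs n\<close> lies between 0 and a constant. Averaging
  the conditional inequality over \<open>A\<close> therefore bounds the integral of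
  \<open>x (Suc (Suc n))\<close> on \<open>A\<close> by a finite number, which yields integrability
  and the sign at once.\<close>

lemma running_step:
  assumes A: "A \<in> sets (H n)" and run: "\<And>\<omega>. \<omega> \<in> A \<Longrightarrow> R m K n \<omega>"
  shows "integrable M (\<lambda>\<omega>. indicator A \<omega> * (x (Suc (Suc n)) \<omega> - rhs n \<omega>))"
    and "(\<integral>\<omega>. indicator A \<omega> * (x (Suc (Suc n)) \<omega> - rhs n \<omega>) \<partial>M) \<le> 0"
proof -
  interpret finite_measure_subalgebra M "H n" by unfold_locales (rule sub)
  have [measurable]: "A \<in> sets M" using A sub[of n] by (auto simp: subalgebra_def)
  let ?y = "\<lambda>\<omega>. x (Suc (Suc n)) \<omega>"
  have "AE \<omega> in M. norm (indicator A \<omega> * rhs n \<omega>) \<le> \<bar>(1 + \<theta> n) * K + m\<bar>"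
    using AE_nonneg AE_cond_exp_le[of n]
  proof eventually_elim
    case (elim \<omega>)
    show ?case
    proof (cases "\<omega> \<in> A")
      case True
      have "rhs n \<omega> \<le> (1 + \<theta> n) * K + m" using elim by (intro running_rhs_le run True) auto
      then show ?thesis using elim True by simp
    qed simp
  qed
  then have int_r: "integrable M (\<lambda>\<omega>. indicator A \<omega> * rhs n \<omega>)"
    by (intro integrable_const_bound) auto
  have "(\<integral>\<^sup>+\<omega>. ennreal (indicator A \<omega> * ?y \<omega>) \<partial>M) = (\<integral>\<^sup>+\<omega>. indicator A \<omega> * ennreal (?y \<omega>) \<partial>M)"
    by (intro nn_integral_cong) (auto simp: indicator_def)
  also have "\<dots> = (\<integral>\<^sup>+\<omega>. indicator A \<omega> * nn_cond_exp M (H n) (\<lambda>\<omega>. ennreal (?y \<omega>)) \<omega> \<partial>M)"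
    using A by (intro nn_cond_exp_intg[symmetric]) auto
  also have "\<dots> \<le> (\<integral>\<^sup>+\<omega>. ennreal (indicator A \<omega> * rhs n \<omega>) \<partial>M)"
  proof (rule nn_integral_mono_AE)
    show "AE \<omega> in M. indicator A \<omega> * nn_cond_exp M (H n) (\<lambda>\<omega>. ennreal (?y \<omega>)) \<omega>
        \<le> ennreal (indicator A \<omega> * rhs n \<omega>)"
      using AE_cond_exp_le[of n] by eventually_elim (auto simp: indicator_def)
  qed
  also have "\<dots> = ennreal (\<integral>\<omega>. indicator A \<omega> * rhs n \<omega> \<partial>M)"
    using AE_cond_exp_le[of n]
    by (intro nn_integral_eq_integral int_r) (auto elim!: eventually_mono)
  finally have le: "(\<integral>\<^sup>+\<omega>. ennreal (indicator A \<omega> * ?y \<omega>) \<partial>M) \<le> ennreal (\<integral>\<omega>. indicator A \<omega> * rhs n \<omega> \<partial>M)" .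
  have y0: "AE \<omega> in M. 0 \<le> indicator A \<omega> * ?y \<omega>"
    using x_nonneg[of "Suc (Suc n)"] by (auto elim!: eventually_mono)
  have int_y: "integrable M (\<lambda>\<omega>. indicator A \<omega> * ?y \<omega>)"
    using le by (intro integrableI_nonneg y0) (auto simp: top.not_eq_extremum[symmetric] top_unique)
  have r0: "0 \<le> (\<integral>\<omega>. indicator A \<omega> * rhs n \<omega> \<partial>M)"
    using AE_cond_exp_le[of n] by (intro integral_nonneg_AE) (auto elim!: eventually_mono)
  have "(\<integral>\<omega>. indicator A \<omega> * ?y \<omega> \<partial>M) \<le> (\<integral>\<omega>. indicator A \<omega> * rhs n \<omega> \<partial>M)"
    using le r0 by (simp add: nn_integral_eq_integral[OF int_y y0])
  then show "(\<integral>\<omega>. indicator A \<omega> * (x (Suc (Suc n)) \<omega> - rhs n \<omega>) \<partial>M) \<le> 0"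
    using int_y int_r by (simp add: right_diff_distrib)
  show "integrable M (\<lambda>\<omega>. indicator A \<omega> * (x (Suc (Suc n)) \<omega> - rhs n \<omega>))"
    using int_y int_r by (simp add: right_diff_distrib)
qed

lemma inertial_path_at:
  assumes "0 \<le> m" "m \<le> K" "\<forall>n. 0 \<le> x n \<omega> \<and> 0 \<le> \<eta> n \<omega> \<and> 0 \<le> \<gamma> n \<omega>"
  shows "inertial_path a (\<lambda>n. x n \<omega>) (\<lambda>n. \<eta> n \<omega>) (\<lambda>n. \<gamma> n \<omega>) C m K"
proof
  show "0 \<le> a n" "a n \<le> C" for n by (fact a_bounds)+
qed (use assms in auto)

lemma stopped_0_bounds:
  assumes "\<forall>n. 0 \<le> x n \<omega> \<and> 0 \<le> \<eta> n \<omega> \<and> 0 \<le> \<gamma> n \<omega>" "0 \<le> m"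
  shows "S m K 0 \<omega> \<le> (1 + C) * m" "- (C * m) \<le> S m K 0 \<omega>"
proof -
  have C: "0 \<le> C" using a_bounds[of 0] by linarith
  have "x 0 \<omega> \<le> m \<Longrightarrow> a 0 * x 0 \<omega> \<le> C * m" "x (Suc 0) \<omega> \<le> m \<Longrightarrow> (1 + a 0) * x (Suc 0) \<omega> \<le> (1 + C) * m"
    using a_bounds[of 0] assms by (auto intro!: mult_mono)
  moreover have "0 \<le> a 0 * x 0 \<omega>" "0 \<le> (1 + a 0) * x (Suc 0) \<omega>" "0 \<le> (1 + C) * m" "0 \<le> C * m"
    using a_bounds[of 0] assms C by (auto intro!: mult_nonneg_nonneg)
  ultimately show "S m K 0 \<omega> \<le> (1 + C) * m" "- (C * m) \<le> S m K 0 \<omega>"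
    unfolding stopped_def lyapunov_def by auto
qed

text \<open>Integrability is inductive, from a bounded start through increments covered by
  \<open>running_step\<close>. For the sign, the event \<open>B\<close> is intersected with the
  event of still running, which also lies in \<open>H n\<close>.\<close>

lemma supermartingale_stopped:
  assumes m: "0 \<le> m" "m \<le> K"
  shows "supermartingale M H (S m K)"
proof
  show "subalgebra M (H n)" for n by (rule sub)
  show "sets (H m) \<subseteq> sets (H n)" if "m \<le> n" for m n using that by (rule mono)
  show "S m K n \<in> borel_measurable (H n)" for n by (rule stopped_measurable)
  have G: "{\<omega> \<in> space M. R m K n \<omega>} \<in> sets (H n)" for n
    using running_measurable[of n n m K] sub[of n] by (auto simp: pred_def subalgebra_def)
  have SM [measurable]: "S m K n \<in> borel_measurable M" for n
    using stopped_measurable measurable_from_subalg[OF sub] by blast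
  show "integrable M (S m K n)" for n
  proof (induction n)
    case 0
    show ?case
    proof (rule integrable_const_bound)
      show "AE \<omega> in M. norm (S m K 0 \<omega>) \<le> (1 + C) * m + C * m"
        using AE_nonneg
      proof eventually_elim
        case (elim \<omega>)
        have "0 \<le> (1 + C) * m" "0 \<le> C * m" using m a_bounds[of 0] by auto
        then show ?case using stopped_0_bounds[OF elim m(1), of K] by (simp add: abs_le_iff)
      qed
    qed simp
  next
    case (Suc n)
    have "integrable M (\<lambda>\<omega>. S m K n \<omega> + (1 + a (Suc n)) *
      (indicator {\<omega> \<in> space M. R m K n \<omega>} \<omega> * (x (Suc (Suc n)) \<omega> - rhs n \<omega>)))"
      using running_step(1)[OF G] Suc by (intro Bochner_Integration.integrable_add integrable_mult_right) auto
    then show ?case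
    proof (rule Bochner_Integration.integrable_cong[THEN iffD1, rotated -1])
      show "S m K n \<omega> + (1 + a (Suc n)) *
        (indicator {\<omega> \<in> space M. R m K n \<omega>} \<omega> * (x (Suc (Suc n)) \<omega> - rhs n \<omega>)) = S m K (Suc n) \<omega>"
        if "\<omega> \<in> space M" for \<omega>
        using that stopped_Suc_diff[where m=m and K=K and n=n and \<omega>=\<omega>] by (auto simp: indicator_def)
    qed simp
  qed
  show "(\<integral>\<omega>. indicator B \<omega> * (S m K (Suc n) \<omega> - S m K n \<omega>) \<partial>M) \<le> 0" if B: "B \<in> sets (H n)" for n B
  proof -
    let ?A = "B \<inter> {\<omega> \<in> space M. R m K n \<omega>}"
    have "(\<integral>\<omega>. indicator B \<omega> * (S m K (Suc n) \<omega> - S m K n \<omega>) \<partial>M)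
      = (\<integral>\<omega>. (1 + a (Suc n)) * (indicator ?A \<omega> * (x (Suc (Suc n)) \<omega> - rhs n \<omega>)) \<partial>M)"
      by (intro Bochner_Integration.integral_cong refl) (auto simp: stopped_Suc_diff indicator_def)
    also have "\<dots> = (1 + a (Suc n)) * (\<integral>\<omega>. indicator ?A \<omega> * (x (Suc (Suc n)) \<omega> - rhs n \<omega>) \<partial>M)"
      by (rule integral_mult_right_zero)
    also have "\<dots> \<le> 0"
    proof (rule mult_nonneg_nonpos)
      show "0 \<le> 1 + a (Suc n)" using a_bounds(1)[of "Suc n"] by simp
      show "(\<integral>\<omega>. indicator ?A \<omega> * (x (Suc (Suc n)) \<omega> - rhs n \<omega>) \<partial>M) \<le> 0"
        by (rule running_step(2)[OF sets.Int[OF B G], where m=m and K=K]) simp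
    qed
    finally show ?thesis .
  qed
qed

lemma AE_stopped_ge:
  assumes "0 \<le> m" "m \<le> K"
  shows "AE \<omega> in M. - (C * K + (1 + C) * m) \<le> S m K n \<omega>"
  using AE_nonneg by eventually_elim (rule inertial_path.stopped_ge[OF inertial_path_at[OF assms]])

lemma AE_stopped_convergent:
  assumes "0 \<le> m" "m \<le> K"
  shows "AE \<omega> in M. convergent (\<lambda>n. S m K n \<omega>)"
  by (rule supermartingale.AE_convergent[OF supermartingale_stopped[OF assms] AE_stopped_ge[OF assms]])

section \<open>Unboundedness has probability zero\<close>

text \<open>Natural numbers as bounds keep the event a countable combination of measurable
  ones.\<close>

definition blowup :: "real \<Rightarrow> 'a set" where
  "blowup m = {\<omega> \<in> space M. (x 0 \<omega> \<le> m \<and> x 1 \<omega> \<le> m) \<and> (\<forall>n. (\<Sum>k\<le>n. \<gamma> k \<omega>) \<le> m)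
     \<and> \<not> (\<exists>B::nat. \<forall>n. x n \<omega> \<le> real B)}"

abbreviation "g m \<omega> \<equiv> exceedance_value m (\<lambda>n. x n \<omega>) (\<lambda>n. \<gamma> n \<omega>)"

lemma blowup_sets [measurable]: "blowup m \<in> sets M"
  unfolding blowup_def by measurable

lemma exceedance_measurable [measurable]: "g m \<in> borel_measurable M"
proof -
  have [measurable]: "(\<lambda>\<omega>. LEAST p. m < (\<Sum>k\<le>p. \<gamma> k \<omega>)) \<in> measurable M (count_space UNIV)"
    by measurable
  have [measurable]: "(\<lambda>\<omega>. x (LEAST p. m < (\<Sum>k\<le>p. \<gamma> k \<omega>)) \<omega>) \<in> borel_measurable M"
    by (rule measurable_compose_countable[where g="\<lambda>\<omega>. LEAST p. m < (\<Sum>k\<le>p. \<gamma> k \<omega>)" and f="x"]) auto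
  show ?thesis unfolding exceedance_value_def by measurable
qed

lemma AE_exceedance_nonneg: "AE \<omega> in M. 0 \<le> g m \<omega>"
  using AE_nonneg by eventually_elim (simp add: exceedance_value_def)

text \<open>Integrates \<open>limit_stopped_ge\<close> against the Fatou bound for the stopped
  supermartingale. The terms \<open>C * K\<close> on both sides cancel; \<open>(1 + C) * m\<close>
  occurs twice, once from the initial value and once from the perturbations.\<close>

lemma blowup_bound:
  assumes m: "0 \<le> m" "m \<le> K"
  shows "K * prob (blowup m) \<le> 2 * ((1 + C) * m) + C * (\<integral>\<omega>. min K (g m \<omega>) \<partial>M)"
proof -
  interpret S: supermartingale M H "S m K" by (rule supermartingale_stopped[OF m])
  let ?L = "C * K + (1 + C) * m"
  \<comment> \<open>The lower bound of \<open>limit_stopped_ge\<close> shifted by \<open>?L\<close>,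
    arranged so that it is visibly nonnegative.\<close>
  let ?f = "\<lambda>\<omega>. K * indicator (blowup m) \<omega> + C * (K - min K (g m \<omega>))"
  have C: "0 \<le> C" using a_bounds[of 0] by linarith
  have K: "0 \<le> K" using m by simp
  have int_min: "integrable M (\<lambda>\<omega>. min K (g m \<omega>))"
  proof (rule integrable_const_bound[where B=K])
    show "AE \<omega> in M. norm (min K (g m \<omega>)) \<le> K"
      using AE_exceedance_nonneg[of m] by eventually_elim (use K in auto)
  qed simp
  have int_1: "integrable M (indicator (blowup m) :: 'a \<Rightarrow> real)"
    by (rule integrable_const_bound[where B=1]) auto
  have int_f: "integrable M ?f"
    by (intro Bochner_Integration.integrable_add integrable_mult_right
        Bochner_Integration.integrable_diff int_1 int_min integrable_const)
  have f0: "0 \<le> ?f \<omega>" for \<omega> using K C by (auto intro!: add_nonneg_nonneg mult_nonneg_nonneg)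
  have "integral\<^sup>L M (S m K 0) \<le> (\<integral>\<omega>. (1 + C) * m \<partial>M)"
  proof (rule integral_mono_AE[OF S.int])
    show "AE \<omega> in M. S m K 0 \<omega> \<le> (1 + C) * m"
      using AE_nonneg by eventually_elim (rule stopped_0_bounds(1)[OF _ m(1)])
  qed simp
  then have ES0: "integral\<^sup>L M (S m K 0) \<le> (1 + C) * m" by (simp add: prob_space)
  have "ennreal (\<integral>\<omega>. ?f \<omega> \<partial>M) = (\<integral>\<^sup>+\<omega>. ennreal (?f \<omega>) \<partial>M)"
    by (rule nn_integral_eq_integral[symmetric, OF int_f]) (use f0 in simp)
  also have "\<dots> \<le> (\<integral>\<^sup>+\<omega>. ennreal (lim (\<lambda>n. S m K n \<omega>) + ?L) \<partial>M)"
  proof (rule nn_integral_mono_AE)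
    show "AE \<omega> in M. ennreal (?f \<omega>) \<le> ennreal (lim (\<lambda>n. S m K n \<omega>) + ?L)"
      using AE_stopped_convergent[OF m] AE_nonneg AE_space
    proof eventually_elim
      case (elim \<omega>)
      interpret P: inertial_path a "\<lambda>n. x n \<omega>" "\<lambda>n. \<eta> n \<omega>" "\<lambda>n. \<gamma> n \<omega>" C m K
        by (rule inertial_path_at[OF m elim(2)])
      have "K * indicator (blowup m) \<omega> - (1 + C) * m - C * min K (g m \<omega>) \<le> lim (\<lambda>n. S m K n \<omega>)"
        using P.limit_stopped_ge[of "lim (\<lambda>n. S m K n \<omega>)"] elim
        by (simp add: convergent_LIMSEQ_iff blowup_def indicator_def)
      then have "?f \<omega> \<le> lim (\<lambda>n. S m K n \<omega>) + ?L"
        unfolding right_diff_distrib by linarith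
      then show ?case by (rule ennreal_leI)
    qed
  qed
  also have "\<dots> \<le> ennreal (integral\<^sup>L M (S m K 0) + ?L)"
    by (rule S.nn_integral_lim_le[OF AE_stopped_ge[OF m]])
  also have "\<dots> \<le> ennreal ((1 + C) * m + ?L)" by (intro ennreal_leI add_right_mono ES0)
  finally have "(\<integral>\<omega>. ?f \<omega> \<partial>M) \<le> (1 + C) * m + ?L"
    by (subst (asm) ennreal_le_iff)
       (intro add_nonneg_nonneg mult_nonneg_nonneg C K m zero_le_one)
  moreover have "(\<integral>\<omega>. ?f \<omega> \<partial>M) = K * prob (blowup m) + C * (K - (\<integral>\<omega>. min K (g m \<omega>) \<partial>M))"
    by (subst Bochner_Integration.integral_add)
       (use int_1 int_min in \<open>simp_all add: prob_space\<close>)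
  ultimately show ?thesis by (simp add: algebra_simps)
qed

text \<open>Dividing \<open>blowup_bound\<close> by \<open>K\<close> and letting \<open>K\<close>
  grow, only the term with \<open>min K (g m)\<close> needs care. No integrability of
  \<open>g m\<close> is at hand, but the quotient by \<open>K\<close> is at most 1 and tends to 0
  pointwise because \<open>g m\<close> is finite, so dominated convergence applies.\<close>

lemma blowup_null: 
  assumes m: "0 \<le> m"
  shows "prob (blowup m) = 0"
proof -
  let ?h = "\<lambda>k \<omega>. min (real k) (g m \<omega>) / real k"
  have "(\<lambda>k. \<integral>\<omega>. ?h k \<omega> \<partial>M) \<longlonglongrightarrow> (\<integral>\<omega>. 0 \<partial>M)"
  proof (rule integral_dominated_convergence[where w="\<lambda>_. 1"])
    show "AE \<omega> in M. (\<lambda>k. ?h k \<omega>) \<longlonglongrightarrow> 0"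
      using AE_exceedance_nonneg[of m]
    proof eventually_elim
      case (elim \<omega>)
      show ?case
      proof (rule tendsto_sandwich[of "\<lambda>_. 0" _ _ "\<lambda>k. g m \<omega> / real k"])
        show "(\<lambda>k. g m \<omega> / real k) \<longlonglongrightarrow> 0" by (rule lim_const_over_n)
        show "\<forall>\<^sub>F k in sequentially. 0 \<le> ?h k \<omega>" using elim by simp
        show "\<forall>\<^sub>F k in sequentially. ?h k \<omega> \<le> g m \<omega> / real k"
          by (intro always_eventually allI divide_right_mono) auto
      qed simp
    qed
    show "AE \<omega> in M. norm (?h k \<omega>) \<le> 1" for k
      using AE_exceedance_nonneg[of m] by eventually_elim (auto simp: divide_le_eq_1)
  qed auto
  then have h: "(\<lambda>k. \<integral>\<omega>. ?h k \<omega> \<partial>M) \<longlonglongrightarrow> 0" by simp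
  have "(\<lambda>k. 2 * ((1 + C) * m) / real k + C * (\<integral>\<omega>. ?h k \<omega> \<partial>M)) \<longlonglongrightarrow> 0 + C * 0"
    by (intro tendsto_add tendsto_mult tendsto_const lim_const_over_n h)
  moreover have "\<forall>\<^sub>F k in sequentially. prob (blowup m) \<le> 2 * ((1 + C) * m) / real k + C * (\<integral>\<omega>. ?h k \<omega> \<partial>M)"
    using eventually_gt_at_top[of "nat \<lceil>m\<rceil>"]
  proof eventually_elim
    case (elim k)
    then have k: "m \<le> real k" "0 < real k" by linarith+
    have "prob (blowup m) \<le> (2 * ((1 + C) * m) + C * (\<integral>\<omega>. min (real k) (g m \<omega>) \<partial>M)) / real k"
      using blowup_bound[OF m k(1)] k(2) by (simp add: le_divide_eq mult.commute)
    then show ?case by (simp add: add_divide_distrib)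
  qed
  ultimately have "prob (blowup m) \<le> 0"
    using tendsto_lowerbound[of _ "0 + C * 0" sequentially "prob (blowup m)"] by simp
  then show ?thesis using measure_nonneg[of M "blowup m"] by linarith
qed

text \<open>Outside countably many null sets, indexed by natural \<open>m\<close> and
  \<open>k\<close>, each path is bounded. Levels can then be chosen for that path so high that its
  stopped process never stops, and \<open>forever_convergent\<close> applies.\<close>

theorem AE_convergent_summable:
  assumes "AE \<omega> in M. summable (\<lambda>n. \<gamma> n \<omega>)"
  shows "AE \<omega> in M. convergent (\<lambda>n. x n \<omega>) \<and> summable (\<lambda>n. \<eta> n \<omega>)"
proof -
  have "AE \<omega> in M. \<omega> \<notin> blowup (real m)" for m :: nat
    using blowup_null[of "real m"] by (intro AE_not_in) (simp add: null_sets_def emeasure_eq_measure)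
  then have nb: "AE \<omega> in M. \<forall>m::nat. \<omega> \<notin> blowup (real m)" by (simp add: AE_all_countable)
  have conv: "AE \<omega> in M. \<forall>m k. m \<le> k \<longrightarrow> convergent (\<lambda>n. S (real m) (real k) n \<omega>)"
    unfolding AE_all_countable
  proof (intro allI)
    fix m k :: nat
    show "AE \<omega> in M. m \<le> k \<longrightarrow> convergent (\<lambda>n. S (real m) (real k) n \<omega>)"
      by (cases "m \<le> k") (use AE_stopped_convergent[of "real m" "real k"] in auto)
  qed
  show ?thesis
    using nb conv AE_nonneg AE_space assms
  proof eventually_elim
    case (elim \<omega>)
    define m where "m = nat \<lceil>Max {x 0 \<omega>, x 1 \<omega>, \<Sum>n. \<gamma> n \<omega>}\<rceil>"
    have "Max {x 0 \<omega>, x 1 \<omega>, \<Sum>n. \<gamma> n \<omega>} \<le> real m" unfolding m_def by linarith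
    then have m: "x 0 \<omega> \<le> real m" "x 1 \<omega> \<le> real m" "(\<Sum>n. \<gamma> n \<omega>) \<le> real m" by auto
    have gm: "(\<Sum>k\<le>n. \<gamma> k \<omega>) \<le> real m" for n
      using sum_le_suminf[OF elim(5), of "{..n}"] elim(3) m(3) by fastforce
    have "\<exists>B::nat. \<forall>n. x n \<omega> \<le> real B"
    proof (rule ccontr)
      assume "\<not> ?thesis"
      then have "\<omega> \<in> blowup (real m)" using elim(4) m gm unfolding blowup_def by simp
      then show False using elim(1) by blast
    qed
    then obtain B :: nat where B: "\<And>n. x n \<omega> \<le> real B" by blast
    \<comment> \<open>Above \<open>B\<close> so that the path never leaves the level, and above
      \<open>m\<close> as the path analysis requires.\<close>
    define K where "K = max m B"
    interpret P: inertial_path a "\<lambda>n. x n \<omega>" "\<lambda>n. \<eta> n \<omega>" "\<lambda>n. \<gamma> n \<omega>" C "real m" "real K"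
      by (rule inertial_path_at[OF _ _ elim(3)]) (simp_all add: K_def)
    have "x n \<omega> \<le> real K" for n using B[of n] by (simp add: K_def)
    then have run: "R (real m) (real K) k \<omega>" for k
      using m gm by (simp add: running_def)
    have "convergent (\<lambda>n. S (real m) (real K) n \<omega>)" using elim(2) by (simp add: K_def)
    then obtain l where l: "(\<lambda>n. S (real m) (real K) n \<omega>) \<longlonglongrightarrow> l" by (auto simp: convergent_def)
    show ?case using P.forever_convergent(1,2)[OF run l] by simp
  qed
qed

end

section \<open>The coupled recursions for \<open>r\<close> and \<open>z\<close>\<close>

text \<open>A positive limit would give \<open>z n > l / 2\<close> eventually, so \<open>w\<close>
  would be dominated by the summable \<open>2 / l * (w n * z n)\<close>.\<close>

lemma limit_zero_if_weighted_summable: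
  fixes w z :: "nat \<Rightarrow> real"
  assumes lim: "z \<longlonglongrightarrow> l" and z: "\<And>n. 0 \<le> z n" and w: "\<And>n. 0 \<le> w n"
    and sm: "summable (\<lambda>n. w n * z n)" and nsm: "\<not> summable w"
  shows "l = 0"
proof (rule ccontr)
  assume "l \<noteq> 0"
  moreover have "0 \<le> l" using lim z by (intro LIMSEQ_le_const) auto
  ultimately have l: "0 < l" by simp
  have "\<forall>\<^sub>F n in sequentially. l / 2 < z n"
    using l by (intro order_tendstoD(1)[OF lim]) simp
  then obtain N where N: "\<And>n. n \<ge> N \<Longrightarrow> l / 2 < z n" by (auto simp: eventually_sequentially)
  have "summable w"
  proof (rule summable_comparison_test'[of "\<lambda>n. 2 / l * (w n * z n)" N])
    show "summable (\<lambda>n. 2 / l * (w n * z n))" by (intro summable_mult sm)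
    fix n assume "n \<ge> N"
    then have "w n * (l / 2) \<le> w n * z n" using N w by (intro mult_left_mono) (auto intro: less_imp_le)
    then show "norm (w n) \<le> 2 / l * (w n * z n)" using l w[of n] by (simp add: field_simps)
  qed
  then show False using nsm by simp
qed

theorem lemma10:
  fixes M :: "'a measure"
    and F :: "nat \<Rightarrow> 'a measure"
    and r z \<eta> \<eta>' \<beta> \<beta>' \<zeta> :: "nat \<Rightarrow> 'a \<Rightarrow> real"
    and \<theta> :: "nat \<Rightarrow> real"
    and c d h :: real
  assumes prob: "prob_space M"
    and filt: "filtration (space M) F" "\<And>n. subalgebra M (F n)"
    and adapted:
      "\<And>n. n \<ge> 1 \<Longrightarrow> r n \<in> borel_measurable (F n)"
      "\<And>n. n \<ge> 1 \<Longrightarrow> z n \<in> borel_measurable (F n)"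
    and nonneg_rz:
      "\<And>n. n \<ge> 1 \<Longrightarrow> AE \<omega> in M. 0 \<le> r n \<omega>"
      "\<And>n. n \<ge> 1 \<Longrightarrow> AE \<omega> in M. 0 \<le> z n \<omega>"
    and theta: "{c..d} \<subseteq> {0..<1}" "\<And>n. n \<ge> 1 \<Longrightarrow> \<theta> n \<in> {c..d}"
    and h: "h > 0"
    and meas:
      "\<And>n. n \<ge> 1 \<Longrightarrow> \<eta> n \<in> borel_measurable (F (n + 1))"
      "\<And>n. n \<ge> 1 \<Longrightarrow> \<eta>' n \<in> borel_measurable (F (n + 1))"
      "\<And>n. n \<ge> 1 \<Longrightarrow> \<beta> n \<in> borel_measurable (F (n + 1))"
      "\<And>n. n \<ge> 1 \<Longrightarrow> \<beta>' n \<in> borel_measurable (F (n + 1))"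
      "\<And>n. n \<ge> 1 \<Longrightarrow> \<zeta> n \<in> borel_measurable (F (n + 1))"
    and nonneg:
      "\<And>n. n \<ge> 1 \<Longrightarrow> AE \<omega> in M. 0 \<le> \<eta> n \<omega>"
      "\<And>n. n \<ge> 1 \<Longrightarrow> AE \<omega> in M. 0 \<le> \<eta>' n \<omega>"
      "\<And>n. n \<ge> 1 \<Longrightarrow> AE \<omega> in M. 0 \<le> \<beta> n \<omega>"
      "\<And>n. n \<ge> 1 \<Longrightarrow> AE \<omega> in M. 0 \<le> \<beta>' n \<omega>"
      "\<And>n. n \<ge> 1 \<Longrightarrow> AE \<omega> in M. 0 \<le> \<zeta> n \<omega>"
    and sums:
      "AE \<omega> in M. summable (\<lambda>k. \<beta> (Suc k) \<omega>)"
      "AE \<omega> in M. summable (\<lambda>k. \<beta>' (Suc k) \<omega>)"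
    and rec_r: "\<And>n. n \<ge> 1 \<Longrightarrow> AE \<omega> in M.
        nonneg_cond_exp M (F (n + 1)) (r (n + 2)) \<omega>
          \<le> ereal (((1 + \<theta> n) * r (n + 1) \<omega> - \<theta> n * r n \<omega>) - \<eta> n \<omega> + \<beta> n \<omega>
                    + h * \<zeta> n \<omega> * z (n + 1) \<omega>)"
    and rec_z: "\<And>n. n \<ge> 1 \<Longrightarrow> AE \<omega> in M.
        nonneg_cond_exp M (F (n + 1)) (z (n + 2)) \<omega>
          \<le> ereal ((1 - \<zeta> n \<omega>) * z (n + 1) \<omega> - \<eta>' n \<omega> + \<beta>' n \<omega>)"
  shows "(\<exists>r_lim \<in> borel_measurable M. AE \<omega> in M. (\<lambda>n. r n \<omega>) \<longlonglongrightarrow> (r_lim \<omega> :: real))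
    \<and> (\<exists>z_lim \<in> borel_measurable M. AE \<omega> in M. (\<lambda>n. z n \<omega>) \<longlonglongrightarrow> (z_lim \<omega> :: real))
    \<and> (AE \<omega> in M. summable (\<lambda>k. \<eta> (Suc k) \<omega>))
    \<and> ((AE \<omega> in M. \<not> summable (\<lambda>k. \<zeta> (Suc k) \<omega>)) \<longrightarrow>
         (AE \<omega> in M. (\<lambda>n. z (n + 1) \<omega>) \<longlonglongrightarrow> 0)
         \<and> (\<exists>r_inf \<in> borel_measurable M.
               AE \<omega> in M. (\<lambda>n. r (n + 1) \<omega>) \<longlonglongrightarrow> (r_inf \<omega> :: real)))"
proof -
  interpret prob_space M by (rule prob)
  have mono: "sets (F m) \<subseteq> sets (F n)" if "m \<le> n" for m n
    using filt(1) that by (auto simp: filtration_def)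
  have lift: "f \<in> borel_measurable (F n)" if "f \<in> borel_measurable (F m)" "m \<le> n"
    for f :: "'a \<Rightarrow> real" and m n
  proof -
    have "subalgebra (F n) (F m)"
      using filt(2)[of n] filt(2)[of m] mono[OF that(2)] by (auto simp: subalgebra_def)
    then show ?thesis using that(1) by (rule measurable_from_subalg)
  qed
  have [measurable]: "(\<lambda>\<omega>. r (Suc n) \<omega>) \<in> borel_measurable M" "(\<lambda>\<omega>. z (Suc n) \<omega>) \<in> borel_measurable M" for n
    using measurable_from_subalg[OF filt(2) adapted(1), of "Suc n"]
      measurable_from_subalg[OF filt(2) adapted(2), of "Suc n"] by simp_all
  \<comment> \<open>The value \<open>\<theta> 1\<close> shows that the interval is nonempty; hence
    it contains its endpoints, and these inherit the bounds 0 and 1.\<close>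
  have "c \<le> \<theta> 1" "\<theta> 1 \<le> d" using theta(2)[of 1] by auto
  then have "c \<in> {c..d}" "d \<in> {c..d}" by simp_all
  then have "c \<in> {0..<1}" "d \<in> {0..<1}" using theta(1) by blast+
  then have cd: "0 \<le> c" "d < 1" by simp_all
  have \<theta>: "0 \<le> \<theta> (Suc n)" "\<theta> (Suc n) \<le> d" for n
    using theta(2)[of "Suc n"] cd by auto
  obtain a where a: "\<And>n. a n = \<theta> (Suc n) * (1 + a (Suc n))" "\<And>n. 0 \<le> a n" "\<And>n. a n \<le> d / (1 - d)"
    using inertial_weights[of "\<lambda>n. \<theta> (Suc n)" d] \<theta> cd(2) by blast
  \<comment> \<open>The sequences start at index 1, so time \<open>n\<close> of the abstract process
    is \<open>Suc n\<close> here, and the recursion at \<open>Suc n\<close> conditions on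
    \<open>F (Suc (Suc n))\<close>.\<close>
  let ?H = "\<lambda>n. F (Suc (Suc n))"
  note meas' = meas[of "Suc _", simplified]
  note nonneg' = nonneg[of "Suc _", simplified]
  have adapted': "(\<lambda>\<omega>. r (Suc n) \<omega>) \<in> borel_measurable (?H n)" "(\<lambda>\<omega>. r (Suc (Suc n)) \<omega>) \<in> borel_measurable (?H n)"
    "(\<lambda>\<omega>. z (Suc n) \<omega>) \<in> borel_measurable (?H n)" "(\<lambda>\<omega>. z (Suc (Suc n)) \<omega>) \<in> borel_measurable (?H n)" for n
    using lift[OF adapted(1)[of "Suc n"], of "Suc (Suc n)"] adapted(1)[of "Suc (Suc n)"]
      lift[OF adapted(2)[of "Suc n"], of "Suc (Suc n)"] adapted(2)[of "Suc (Suc n)"] by simp_all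
  have z_nonneg: "AE \<omega> in M. 0 \<le> z (Suc n) \<omega>" and r_nonneg: "AE \<omega> in M. 0 \<le> r (Suc n) \<omega>" for n
    using nonneg_rz[of "Suc n"] by simp_all
  have \<zeta>z_nonneg: "AE \<omega> in M. 0 \<le> \<zeta> (Suc n) \<omega> * z (Suc (Suc n)) \<omega>" for n
    using nonneg'(5)[of n] z_nonneg[of "Suc n"] by eventually_elim simp
  have \<zeta>z_meas: "(\<lambda>\<omega>. \<zeta> (Suc n) \<omega> * z (Suc (Suc n)) \<omega>) \<in> borel_measurable (?H n)" for n
    by (intro borel_measurable_times meas' adapted')
  \<comment> \<open>Without inertia all weights are 0. The decrease
    \<open>\<zeta> n * z (n + 1)\<close> is treated as part of the nonnegative \<open>\<eta>\<close>
    term, so its summability comes out together with the convergence of \<open>z\<close>.\<close>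
  interpret Z: inertial_process M ?H "\<lambda>n. z (Suc n)"
    "\<lambda>n \<omega>. \<zeta> (Suc n) \<omega> * z (Suc (Suc n)) \<omega> + \<eta>' (Suc n) \<omega>" "\<lambda>n. \<beta>' (Suc n)" "\<lambda>_. 0" "\<lambda>_. 0" 0
  proof
    show "subalgebra M (?H n)" for n by (rule filt(2))
    show "sets (?H m) \<subseteq> sets (?H n)" if "m \<le> n" for m n using that by (intro mono) simp
    show "z (Suc n) \<in> borel_measurable (?H n)" "z (Suc (Suc n)) \<in> borel_measurable (?H n)" for n
      by (rule adapted')+
    show "(\<lambda>\<omega>. \<zeta> (Suc n) \<omega> * z (Suc (Suc n)) \<omega> + \<eta>' (Suc n) \<omega>) \<in> borel_measurable (?H n)" for n
      by (intro borel_measurable_add \<zeta>z_meas meas')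
    show "\<beta>' (Suc n) \<in> borel_measurable (?H n)" for n by (rule meas')
    show "AE \<omega> in M. 0 \<le> z (Suc n) \<omega>" for n by (rule z_nonneg)
    show "AE \<omega> in M. 0 \<le> \<zeta> (Suc n) \<omega> * z (Suc (Suc n)) \<omega> + \<eta>' (Suc n) \<omega>" for n
      using \<zeta>z_nonneg[of n] nonneg'(2)[of n] by eventually_elim simp
    show "AE \<omega> in M. 0 \<le> \<beta>' (Suc n) \<omega>" for n by (rule nonneg')
    show "AE \<omega> in M. nonneg_cond_exp M (?H n) (z (Suc (Suc (Suc n)))) \<omega>
        \<le> ereal ((1 + 0) * z (Suc (Suc n)) \<omega> - 0 * z (Suc n) \<omega>
             - (\<zeta> (Suc n) \<omega> * z (Suc (Suc n)) \<omega> + \<eta>' (Suc n) \<omega>) + \<beta>' (Suc n) \<omega>)" for n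
      using rec_z[of "Suc n"] by (simp add: algebra_simps)
  qed simp_all
  have Z: "AE \<omega> in M. convergent (\<lambda>n. z (Suc n) \<omega>)
      \<and> summable (\<lambda>n. \<zeta> (Suc n) \<omega> * z (Suc (Suc n)) \<omega> + \<eta>' (Suc n) \<omega>)"
    by (rule Z.AE_convergent_summable) (rule sums)
  have nonneg_all: "AE \<omega> in M. \<forall>n. 0 \<le> \<zeta> (Suc n) \<omega> \<and> 0 \<le> z (Suc n) \<omega> \<and> 0 \<le> \<eta>' (Suc n) \<omega>"
    using z_nonneg nonneg' by (simp add: AE_all_countable)
  have \<zeta>z: "AE \<omega> in M. summable (\<lambda>n. \<zeta> (Suc n) \<omega> * z (Suc (Suc n)) \<omega>)"
    using Z nonneg_all
  proof eventually_elim
    case (elim \<omega>)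
    show ?case
      by (rule summable_comparison_test'[OF conjunct2[OF elim(1)], of 0]) (use elim(2) in auto)
  qed
  \<comment> \<open>The coupling term now counts as a perturbation, since \<open>\<zeta>z\<close>
    has shown it to be summable almost surely.\<close>
  interpret R: inertial_process M ?H "\<lambda>n. r (Suc n)" "\<lambda>n. \<eta> (Suc n)"
    "\<lambda>n \<omega>. \<beta> (Suc n) \<omega> + h * (\<zeta> (Suc n) \<omega> * z (Suc (Suc n)) \<omega>)" "\<lambda>n. \<theta> (Suc n)" a "d / (1 - d)"
  proof
    show "subalgebra M (?H n)" for n by (rule filt(2))
    show "sets (?H m) \<subseteq> sets (?H n)" if "m \<le> n" for m n using that by (intro mono) simp
    show "r (Suc n) \<in> borel_measurable (?H n)" "r (Suc (Suc n)) \<in> borel_measurable (?H n)" for n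
      by (rule adapted')+
    show "\<eta> (Suc n) \<in> borel_measurable (?H n)" for n by (rule meas')
    show "(\<lambda>\<omega>. \<beta> (Suc n) \<omega> + h * (\<zeta> (Suc n) \<omega> * z (Suc (Suc n)) \<omega>)) \<in> borel_measurable (?H n)" for n
      by (intro borel_measurable_add borel_measurable_times borel_measurable_const \<zeta>z_meas meas' adapted')
    show "AE \<omega> in M. 0 \<le> r (Suc n) \<omega>" for n by (rule r_nonneg)
    show "AE \<omega> in M. 0 \<le> \<eta> (Suc n) \<omega>" for n by (rule nonneg')
    show "AE \<omega> in M. 0 \<le> \<beta> (Suc n) \<omega> + h * (\<zeta> (Suc n) \<omega> * z (Suc (Suc n)) \<omega>)" for n
      using \<zeta>z_nonneg[of n] nonneg'(3)[of n] by eventually_elim (use h in simp)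
    show "AE \<omega> in M. nonneg_cond_exp M (?H n) (r (Suc (Suc (Suc n)))) \<omega>
        \<le> ereal ((1 + \<theta> (Suc n)) * r (Suc (Suc n)) \<omega> - \<theta> (Suc n) * r (Suc n) \<omega> - \<eta> (Suc n) \<omega>
             + (\<beta> (Suc n) \<omega> + h * (\<zeta> (Suc n) \<omega> * z (Suc (Suc n)) \<omega>)))" for n
      using rec_r[of "Suc n"] by (simp add: algebra_simps)
  qed (fact a \<theta>)+
  have R: "AE \<omega> in M. convergent (\<lambda>n. r (Suc n) \<omega>) \<and> summable (\<lambda>n. \<eta> (Suc n) \<omega>)"
  proof (rule R.AE_convergent_summable)
    show "AE \<omega> in M. summable (\<lambda>n. \<beta> (Suc n) \<omega> + h * (\<zeta> (Suc n) \<omega> * z (Suc (Suc n)) \<omega>))"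
      using sums(1) \<zeta>z by eventually_elim (intro summable_add summable_mult)
  qed
  have conv: "\<exists>l\<in>borel_measurable M. AE \<omega> in M. (\<lambda>n. y (Suc n) \<omega>) \<longlonglongrightarrow> l \<omega>"
    if "AE \<omega> in M. convergent (\<lambda>n. y (Suc n) \<omega>)" "\<And>n. (\<lambda>\<omega>. y (Suc n) \<omega>) \<in> borel_measurable M"
    for y :: "nat \<Rightarrow> 'a \<Rightarrow> real"
  proof (rule bexI)
    \<comment> \<open>The function \<open>lim\<close> is measurable everywhere; its values on the
      null set of divergent paths do not affect the almost sure claim.\<close>
    show "(\<lambda>\<omega>. lim (\<lambda>n. y (Suc n) \<omega>)) \<in> borel_measurable M"
      by (intro borel_measurable_lim_metric that)
    show "AE \<omega> in M. (\<lambda>n. y (Suc n) \<omega>) \<longlonglongrightarrow> lim (\<lambda>n. y (Suc n) \<omega>)"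
      using that(1) by (simp add: convergent_LIMSEQ_iff)
  qed
  have r_conv: "\<exists>l\<in>borel_measurable M. AE \<omega> in M. (\<lambda>n. r (Suc n) \<omega>) \<longlonglongrightarrow> l \<omega>"
    by (rule conv) (use R in \<open>auto elim: eventually_mono\<close>)
  have z_conv: "\<exists>l\<in>borel_measurable M. AE \<omega> in M. (\<lambda>n. z (Suc n) \<omega>) \<longlonglongrightarrow> l \<omega>"
    by (rule conv) (use Z in \<open>auto elim: eventually_mono\<close>)
  have z_zero: "AE \<omega> in M. (\<lambda>n. z (Suc n) \<omega>) \<longlonglongrightarrow> 0" if "AE \<omega> in M. \<not> summable (\<lambda>k. \<zeta> (Suc k) \<omega>)"
    using that Z \<zeta>z nonneg_all
  proof eventually_elim
    case (elim \<omega>)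
    obtain l where l: "(\<lambda>n. z (Suc n) \<omega>) \<longlonglongrightarrow> l" using elim(2) by (auto simp: convergent_def)
    \<comment> \<open>The weight \<open>\<zeta> (Suc n)\<close> is paired with
      \<open>z (Suc (Suc n))\<close>, hence the limit is shifted by one index.\<close>
    have "l = 0"
      by (rule limit_zero_if_weighted_summable[OF LIMSEQ_Suc[OF l], of "\<lambda>n. \<zeta> (Suc n) \<omega>"])
         (use elim in auto)
    then show ?case using l by simp
  qed
  show ?thesis
  proof (intro conjI impI)
    show "\<exists>r_lim\<in>borel_measurable M. AE \<omega> in M. (\<lambda>n. r n \<omega>) \<longlonglongrightarrow> r_lim \<omega>"
      using r_conv by (simp only: filterlim_sequentially_Suc[where f="\<lambda>n. r n _"])
    show "\<exists>z_lim\<in>borel_measurable M. AE \<omega> in M. (\<lambda>n. z n \<omega>) \<longlonglongrightarrow> z_lim \<omega>"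
      using z_conv by (simp only: filterlim_sequentially_Suc[where f="\<lambda>n. z n _"])
    show "AE \<omega> in M. summable (\<lambda>k. \<eta> (Suc k) \<omega>)" using R by (auto elim: eventually_mono)
    show "\<exists>r_inf\<in>borel_measurable M. AE \<omega> in M. (\<lambda>n. r (n + 1) \<omega>) \<longlonglongrightarrow> r_inf \<omega>"
      using r_conv by simp
    assume "AE \<omega> in M. \<not> summable (\<lambda>k. \<zeta> (Suc k) \<omega>)"
    from z_zero[OF this] show "AE \<omega> in M. (\<lambda>n. z (n + 1) \<omega>) \<longlonglongrightarrow> 0" by simp
  qed
qed

end
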